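(* Let $M$ be a smooth manifold. A vector bundle morphism $\lambda:T^*M\to TM$ (over the identity of $M$) defines a Poisson structure on $M$ if and only if $$T\lambda\circ\widetilde{\Lambda_M}^1\circ T^*\lambda=\kappa_M\circ T\lambda\circ\varepsilon_M$$ as relations from $T^*_{\mathrm{im}(\lambda)}TM$ to $TTM$; that is, if and only if for every $a\in T^*M$ and every $\xi\in T^*_{\lambda(a)}TM$, $$T\lambda\big(\widetilde{\Lambda_M}^1(\xi\circ T_a\lambda)\big)=\kappa_M\big(T\lambda(\varepsilon_M(\xi))\big).$$
   Context: Everything is smooth. "$\lambda$ defines a Poisson structure" means there is a bivector field $\Lambda$ on $M$ with vanishing Schouten bracket $[\Lambda,\Lambda]=0$ and $\lambda=\widetilde\Lambda^1$, where $\widetilde\Lambda^1(a)=i_a\Lambda$, i.e. $\langle b,\widetilde\Lambda^1(a)\rangle=\Lambda(a,b)$. $T^*_{\mathrm{im}(\lambda)}TM$ is the part of $T^*TM$ over the image of $\lambda$. $T^*\lambda$ is the relation from $T^*_{\mathrm{im}(\lambda)}TM$ to $T^*T^*M$ relating $\xi\in T^*_{\lambda(a)}TM$ to $\xi\circ T_a\lambda\in T^*_aT^*M$ for $a\in T^*M$ (in general not a mapping). $T\lambda:TT^*M\to TTM$ is the tangent map. $\Lambda_M$ is the canonical bivector field on $T^*M$, $\Lambda_M=\sum_i\partial_{x^i}\wedge\partial_{p_i}$ in canonical coordinates, and $\widetilde{\Lambda_M}^1:T^*T^*M\to TT^*M$ is $b\mapsto i_b\Lambda_M$. $\kappa_M:TTM\to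 TTM$ is the canonical flip, in coordinates $(x,\dot x,\delta x,\delta\dot x)\mapsto(x,\delta x,\dot x,\delta\dot x)$. $\varepsilon_M:T^*TM\to TT^*M$ is the inverse of the isomorphism $\alpha_M:TT^*M\to T^*TM$ of vector bundles over $TM$ defined by $\langle v,\alpha_M(w)\rangle=\langle\kappa_M(v),w\rangle'$, where $\langle\cdot,\cdot\rangle':TTM\times_{TM}TT^*M\to\mathbb R$ is the derivative component of the tangent map of the pairing $TM\times_MT^*M\to\mathbb R$. In coordinates $\alpha_M(x,p,\dot x,\dot p)=(x,\dot x,\pi=\dot p,\dot\pi=p)$, where $\pi,\dot\pi$ are conjugate to $x,\dot x$. *)

theory Defs
  imports "HOL-Analysis.Analysis"
begin

section \<open>Smooth maps between normed spaces\<close>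

text \<open>The domain \<open>S\<close> is meant to be open, and the spaces to be finite-dimensional, so that
  continuity of all directional derivatives is continuity of the derivative.\<close>

primrec Ck_on :: "nat \<Rightarrow> 'a::real_normed_vector set \<Rightarrow> ('a \<Rightarrow> 'b::real_normed_vector) \<Rightarrow> bool" where
  "Ck_on 0 S f \<longleftrightarrow> continuous_on S f"
| "Ck_on (Suc k) S f \<longleftrightarrow>
     (\<forall>x\<in>S. f differentiable (at x)) \<and> (\<forall>v. Ck_on k S (\<lambda>x. frechet_derivative f (at x) v))"

definition smooth_on :: "'a::real_normed_vector set \<Rightarrow> ('a \<Rightarrow> 'b::real_normed_vector) \<Rightarrow> bool" where
  "smooth_on S f \<longleftrightarrow> (\<forall>k. Ck_on k S f)"


section \<open>Smooth manifolds\<close>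

text \<open>
  A manifold is given by an atlas of charts with values in a finite-dimensional inner product
  space \<open>'e\<close>; its underlying set and its topology are determined by the atlas.  The class
  \<open>euclidean_space\<close> is not used for \<open>'e\<close> because it excludes dimension 0.
  Only the values of \<open>cmap c\<close> on \<open>cdom c\<close> matter.
\<close>

datatype ('a, 'e) chart = Chart (cdom: "'a set") (cmap: "'a \<Rightarrow> 'e")

type_synonym ('a, 'e) atlas = "('a, 'e) chart set"

definition cinv :: "('a, 'e) chart \<Rightarrow> 'e \<Rightarrow> 'a" where
  "cinv c = inv_into (cdom c) (cmap c)"

definition points :: "('a, 'e) atlas \<Rightarrow> 'a set" where
  "points A = (\<Union>c\<in>A. cdom c)"

definition smooth_atlas :: "('a, 'e::real_normed_vector) atlas \<Rightarrow> bool" where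
  "smooth_atlas A \<longleftrightarrow>
     (\<forall>c\<in>A. inj_on (cmap c) (cdom c)) \<and>
     (\<forall>c\<in>A. \<forall>d\<in>A. open (cmap c ` (cdom c \<inter> cdom d)) \<and>
        smooth_on (cmap c ` (cdom c \<inter> cdom d)) (cmap d \<circ> cinv c))"

definition atlas_topology :: "('a, 'e::real_normed_vector) atlas \<Rightarrow> 'a topology" where
  "atlas_topology A =
     topology (\<lambda>U. U \<subseteq> points A \<and> (\<forall>c\<in>A. open (cmap c ` (U \<inter> cdom c))))"

definition finite_dimensional :: "'e::real_vector itself \<Rightarrow> bool" where
  "finite_dimensional _ \<longleftrightarrow> (\<exists>B::'e set. finite B \<and> span B = UNIV)"

definition smooth_manifold :: "('a, 'e::real_normed_vector) atlas \<Rightarrow> bool" where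
  "smooth_manifold A \<longleftrightarrow>
     finite_dimensional TYPE('e) \<and> smooth_atlas A \<and>
     Hausdorff_space (atlas_topology A) \<and> second_countable (atlas_topology A)"

definition smooth_map ::
  "('a, 'e::real_normed_vector) atlas \<Rightarrow> ('b, 'f::real_normed_vector) atlas \<Rightarrow> ('a \<Rightarrow> 'b) \<Rightarrow> bool" where
  "smooth_map A B f \<longleftrightarrow> f ` points A \<subseteq> points B \<and>
     (\<forall>c\<in>A. \<forall>d\<in>B. open (cmap c ` (cdom c \<inter> f -` cdom d)) \<and>
        smooth_on (cmap c ` (cdom c \<inter> f -` cdom d)) (cmap d \<circ> f \<circ> cinv c))"

definition chart_at :: "('a, 'e) atlas \<Rightarrow> 'a \<Rightarrow> ('a, 'e) chart" where
  "chart_at A p = (SOME c. c \<in> A \<and> p \<in> cdom c)"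

definition real_line :: "(real, real) atlas" where
  "real_line = {Chart UNIV (\<lambda>t. t)}"


section \<open>Tangent bundle\<close>

text \<open>
  A tangent vector at \<open>p\<close> is the family of its components in all charts around \<open>p\<close>, subject to
  the usual transformation law (and 0 for all other charts).
\<close>

type_synonym ('a, 'e) tvec = "('a, 'e) chart \<Rightarrow> 'e"

definition tangent_space :: "('a, 'e::real_normed_vector) atlas \<Rightarrow> 'a \<Rightarrow> ('a, 'e) tvec set" where
  "tangent_space A p =
     {v. (\<forall>c. \<not> (c \<in> A \<and> p \<in> cdom c) \<longrightarrow> v c = 0) \<and>
         (\<forall>c\<in>A. \<forall>d\<in>A. p \<in> cdom c \<and> p \<in> cdom d \<longrightarrow>
            v d = frechet_derivative (cmap d \<circ> cinv c) (at (cmap c p)) (v c))}"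

text \<open>\<open>tvec_of A c p u\<close> is the tangent vector at \<open>p\<close> whose component in the chart \<open>c\<close> is \<open>u\<close>.\<close>

definition tvec_of ::
  "('a, 'e::real_normed_vector) atlas \<Rightarrow> ('a, 'e) chart \<Rightarrow> 'a \<Rightarrow> 'e \<Rightarrow> ('a, 'e) tvec" where
  "tvec_of A c p u =
     (\<lambda>d. if d \<in> A \<and> p \<in> cdom d
          then frechet_derivative (cmap d \<circ> cinv c) (at (cmap c p)) u else 0)"

definition tangent_chart ::
  "('a, 'e::real_normed_vector) atlas \<Rightarrow> ('a, 'e) chart \<Rightarrow> ('a \<times> ('a, 'e) tvec, 'e \<times> 'e) chart" where
  "tangent_chart A c =
     Chart (SIGMA p:cdom c. tangent_space A p) (\<lambda>(p, v). (cmap c p, v c))"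

definition tangent ::
  "('a, 'e::real_normed_vector) atlas \<Rightarrow> ('a \<times> ('a, 'e) tvec, 'e \<times> 'e) atlas" where
  "tangent A = tangent_chart A ` A"

text \<open>The tangent map; for smooth \<open>f\<close> it does not depend on the chart used at \<open>p\<close>.\<close>

definition tangent_map ::
  "('a, 'e::real_normed_vector) atlas \<Rightarrow> ('b, 'f::real_normed_vector) atlas \<Rightarrow> ('a \<Rightarrow> 'b) \<Rightarrow>
     'a \<times> ('a, 'e) tvec \<Rightarrow> 'b \<times> ('b, 'f) tvec" where
  "tangent_map A B f = (\<lambda>(p, v).
     (f p, let c = chart_at A p in
           (\<lambda>d. if d \<in> B \<and> f p \<in> cdom d
                then frechet_derivative (cmap d \<circ> f \<circ> cinv c) (at (cmap c p)) (v c) else 0)))"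


section \<open>Cotangent bundle\<close>

text \<open>Covectors are linear forms on the tangent space, extended by 0.\<close>

type_synonym ('a, 'e) covec = "('a, 'e) tvec \<Rightarrow> real"

definition cotangent_space :: "('a, 'e::real_normed_vector) atlas \<Rightarrow> 'a \<Rightarrow> ('a, 'e) covec set" where
  "cotangent_space A p =
     {\<alpha>. (\<forall>v. v \<notin> tangent_space A p \<longrightarrow> \<alpha> v = 0) \<and>
         (\<forall>v\<in>tangent_space A p. \<forall>w\<in>tangent_space A p. \<forall>r s.
            \<alpha> (\<lambda>c. r *\<^sub>R v c + s *\<^sub>R w c) = r * \<alpha> v + s * \<alpha> w)}"

text \<open>
  An orthonormal basis of the model space.  The coordinates \<open>x\<^sup>i\<close> in a chart are the
  components with respect to it.
\<close>

definition coord_basis :: "'e::real_inner set" where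
  "coord_basis = (SOME B. finite B \<and> pairwise orthogonal B \<and> (\<forall>i\<in>B. norm i = 1) \<and> span B = UNIV)"

lemma coord_basis:
  assumes "finite_dimensional TYPE('e::real_inner)"
  shows "finite (coord_basis :: 'e set)" "pairwise orthogonal (coord_basis :: 'e set)"
    "\<forall>i\<in>(coord_basis :: 'e set). norm i = 1" "span coord_basis = (UNIV :: 'e set)"
proof -
  obtain B :: "'e set" where B: "finite B" "span B = UNIV"
    using assms unfolding finite_dimensional_def by blast
  obtain C :: "'e set" where C: "finite C" "span C = UNIV" "pairwise orthogonal C"
    using basis_orthogonal[OF B(1)] B(2) by auto
  let ?D = "(\<lambda>x. x /\<^sub>R norm x) ` (C - {0})"
  have "span (C - {0}) \<subseteq> span ?D"
  proof (rule span_minimal)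
    show "C - {0} \<subseteq> span ?D"
    proof
      fix x assume x: "x \<in> C - {0}"
      then have "norm x *\<^sub>R (x /\<^sub>R norm x) \<in> span ?D"
        by (intro span_scale span_base imageI)
      then show "x \<in> span ?D" using x by simp
    qed
  qed simp
  then have "span ?D = UNIV" using C(2) by auto
  moreover have "pairwise orthogonal ?D"
    using C(3) by (auto simp: pairwise_def orthogonal_def)
  ultimately have "\<exists>B::'e set. finite B \<and> pairwise orthogonal B \<and> (\<forall>i\<in>B. norm i = 1) \<and> span B = UNIV"
    using C(1) by (intro exI[of _ ?D]) auto
  from someI_ex[OF this]
  show "finite (coord_basis :: 'e set)" "pairwise orthogonal (coord_basis :: 'e set)"
    "\<forall>i\<in>(coord_basis :: 'e set). norm i = 1" "span coord_basis = (UNIV :: 'e set)"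
    unfolding coord_basis_def by blast+
qed

text \<open>\<open>covec_of A c p w\<close> is \<open>\<Sum>i. w\<^sub>i dx\<^sup>i\<close> at \<open>p\<close> in the chart \<open>c\<close>; conversely,
  \<open>covec_comp A c p \<alpha>\<close> is the vector of components \<open>\<alpha>(\<partial>\<^sub>i)\<close> of \<open>\<alpha>\<close>.\<close>

definition covec_of ::
  "('a, 'e::real_inner) atlas \<Rightarrow> ('a, 'e) chart \<Rightarrow> 'a \<Rightarrow> 'e \<Rightarrow> ('a, 'e) covec" where
  "covec_of A c p w = (\<lambda>v. if v \<in> tangent_space A p then w \<bullet> v c else 0)"

definition covec_comp ::
  "('a, 'e::real_inner) atlas \<Rightarrow> ('a, 'e) chart \<Rightarrow> 'a \<Rightarrow> ('a, 'e) covec \<Rightarrow> 'e" where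
  "covec_comp A c p \<alpha> = (\<Sum>i\<in>coord_basis. \<alpha> (tvec_of A c p i) *\<^sub>R i)"

definition cotangent_chart ::
  "('a, 'e::real_inner) atlas \<Rightarrow> ('a, 'e) chart \<Rightarrow> ('a \<times> ('a, 'e) covec, 'e \<times> 'e) chart" where
  "cotangent_chart A c =
     Chart (SIGMA p:cdom c. cotangent_space A p) (\<lambda>(p, \<alpha>). (cmap c p, covec_comp A c p \<alpha>))"

definition cotangent ::
  "('a, 'e::real_inner) atlas \<Rightarrow> ('a \<times> ('a, 'e) covec, 'e \<times> 'e) atlas" where
  "cotangent A = cotangent_chart A ` A"

text \<open>The relation \<open>T\<^sup>*f\<close>, between \<open>\<xi>\<close> at \<open>f q\<close> and \<open>\<xi> \<circ> T\<^sub>qf\<close> at \<open>q\<close>.\<close>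

definition pullback_covec ::
  "('a, 'e::real_normed_vector) atlas \<Rightarrow> ('b, 'f::real_normed_vector) atlas \<Rightarrow> ('a \<Rightarrow> 'b) \<Rightarrow>
     'a \<Rightarrow> ('b, 'f) covec \<Rightarrow> ('a, 'e) covec" where
  "pullback_covec A B f q \<xi> =
     (\<lambda>v. if v \<in> tangent_space A q then \<xi> (snd (tangent_map A B f (q, v))) else 0)"

definition cotangent_rel ::
  "('a, 'e::real_normed_vector) atlas \<Rightarrow> ('b, 'f::real_normed_vector) atlas \<Rightarrow> ('a \<Rightarrow> 'b) \<Rightarrow>
     (('b \<times> ('b, 'f) covec) \<times> ('a \<times> ('a, 'e) covec)) set" where
  "cotangent_rel A B f =
     {((f q, \<xi>), (q, pullback_covec A B f q \<xi>)) | q \<xi>.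
        q \<in> points A \<and> \<xi> \<in> cotangent_space B (f q)}"


section \<open>Bivector fields and Poisson structures\<close>

type_synonym ('a, 'e) bivec = "'a \<Rightarrow> ('a, 'e) covec \<Rightarrow> ('a, 'e) covec \<Rightarrow> real"

definition bivector_field :: "('a, 'e::real_inner) atlas \<Rightarrow> ('a, 'e) bivec \<Rightarrow> bool" where
  "bivector_field A P \<longleftrightarrow>
     (\<forall>p\<in>points A.
        (\<forall>\<alpha>\<in>cotangent_space A p. P p \<alpha> \<alpha> = 0) \<and>
        (\<forall>\<alpha>\<in>cotangent_space A p. \<forall>\<beta>\<in>cotangent_space A p. \<forall>\<gamma>\<in>cotangent_space A p. \<forall>r s.
           P p (\<lambda>v. r * \<alpha> v + s * \<beta> v) \<gamma> = r * P p \<alpha> \<gamma> + s * P p \<beta> \<gamma> \<and>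
           P p \<gamma> (\<lambda>v. r * \<alpha> v + s * \<beta> v) = r * P p \<gamma> \<alpha> + s * P p \<gamma> \<beta>)) \<and>
     (\<forall>c\<in>A. \<forall>i\<in>coord_basis. \<forall>j\<in>coord_basis.
        smooth_on (cmap c ` cdom c)
          (\<lambda>x. P (cinv c x) (covec_of A c (cinv c x) i) (covec_of A c (cinv c x) j)))"

text \<open>\<open>sharp A P (p, \<alpha>)\<close> is \<open>i\<^sub>\<alpha>P\<close>, i.e. \<open>\<langle>\<beta>, i\<^sub>\<alpha>P\<rangle> = P(\<alpha>, \<beta>)\<close>.\<close>

definition sharp ::
  "('a, 'e::real_normed_vector) atlas \<Rightarrow> ('a, 'e) bivec \<Rightarrow>
     'a \<times> ('a, 'e) covec \<Rightarrow> 'a \<times> ('a, 'e) tvec" where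
  "sharp A P = (\<lambda>(p, \<alpha>).
     (p, THE v. v \<in> tangent_space A p \<and> (\<forall>\<beta>\<in>cotangent_space A p. \<beta> v = P p \<alpha> \<beta>)))"

text \<open>
  The Schouten bracket \<open>[P, Q]\<close> of two bivector fields, as a trivector field.  With
  \<open>P\<^sup>i\<^sup>j = P(dx\<^sup>i, dx\<^sup>j)\<close> its local expression is
  \<open>[P, Q]\<^sup>i\<^sup>j\<^sup>k = \<Sum>\<^sub>l Q\<^sup>i\<^sup>l \<partial>\<^sub>lP\<^sup>j\<^sup>k + P\<^sup>i\<^sup>l \<partial>\<^sub>lQ\<^sup>j\<^sup>k + cyclic permutations of (i, j, k)\<close>,
  which is the extension of the Lie bracket with
  \<open>[X\<^sub>1 \<and> X\<^sub>2, Y\<^sub>1 \<and> Y\<^sub>2] = \<Sum>\<^sub>m\<^sub>,\<^sub>n (-1)\<^sup>m\<^sup>+\<^sup>n [X\<^sub>m, Y\<^sub>n] \<and> X\<^sub>m\<^sub>' \<and> Y\<^sub>n\<^sub>'\<close>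
  (\<open>m'\<close>, \<open>n'\<close> the other indices; authors differ in the overall sign).  The value does not depend
  on the chart used at \<open>p\<close>.
  In \<open>bivec_deriv A c P p \<alpha> \<beta> v\<close>, the function \<open>P(\<alpha>, \<beta>)\<close> is differentiated in the direction \<open>v\<close>
  with the covectors extended to a neighbourhood of \<open>p\<close> with constant components in the chart \<open>c\<close>.
\<close>

definition bivec_deriv ::
  "('a, 'e::real_inner) atlas \<Rightarrow> ('a, 'e) chart \<Rightarrow> ('a, 'e) bivec \<Rightarrow> 'a \<Rightarrow>
     ('a, 'e) covec \<Rightarrow> ('a, 'e) covec \<Rightarrow> ('a, 'e) tvec \<Rightarrow> real" where
  "bivec_deriv A c P p \<alpha> \<beta> v =
     frechet_derivative
       (\<lambda>x. P (cinv c x) (covec_of A c (cinv c x) (covec_comp A c p \<alpha>))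
                         (covec_of A c (cinv c x) (covec_comp A c p \<beta>)))
       (at (cmap c p)) (v c)"

definition schouten ::
  "('a, 'e::real_inner) atlas \<Rightarrow> ('a, 'e) bivec \<Rightarrow> ('a, 'e) bivec \<Rightarrow>
     'a \<Rightarrow> ('a, 'e) covec \<Rightarrow> ('a, 'e) covec \<Rightarrow> ('a, 'e) covec \<Rightarrow> real" where
  "schouten A P Q p \<alpha> \<beta> \<gamma> =
     (let c = chart_at A p;
          t = (\<lambda>\<alpha> \<beta> \<gamma>. bivec_deriv A c P p \<beta> \<gamma> (snd (sharp A Q (p, \<alpha>)))
                     + bivec_deriv A c Q p \<beta> \<gamma> (snd (sharp A P (p, \<alpha>))))
      in t \<alpha> \<beta> \<gamma> + t \<beta> \<gamma> \<alpha> + t \<gamma> \<alpha> \<beta>)"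

definition poisson_bivector :: "('a, 'e::real_inner) atlas \<Rightarrow> ('a, 'e) bivec \<Rightarrow> bool" where
  "poisson_bivector A P \<longleftrightarrow> bivector_field A P \<and>
     (\<forall>p\<in>points A. \<forall>\<alpha>\<in>cotangent_space A p. \<forall>\<beta>\<in>cotangent_space A p. \<forall>\<gamma>\<in>cotangent_space A p.
        schouten A P P p \<alpha> \<beta> \<gamma> = 0)"

text \<open>Vector bundle morphisms \<open>T\<^sup>*M \<rightarrow> TM\<close> over the identity of \<open>M\<close>.\<close>

definition bundle_morphism ::
  "('a, 'e::real_inner) atlas \<Rightarrow> ('a \<times> ('a, 'e) covec \<Rightarrow> 'a \<times> ('a, 'e) tvec) \<Rightarrow> bool" where
  "bundle_morphism A f \<longleftrightarrow>
     smooth_map (cotangent A) (tangent A) f \<and>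
     (\<forall>p\<in>points A. \<forall>\<alpha>\<in>cotangent_space A p. fst (f (p, \<alpha>)) = p) \<and>
     (\<forall>p\<in>points A. \<forall>\<alpha>\<in>cotangent_space A p. \<forall>\<beta>\<in>cotangent_space A p. \<forall>r s.
        snd (f (p, \<lambda>v. r * \<alpha> v + s * \<beta> v)) =
          (\<lambda>c. r *\<^sub>R snd (f (p, \<alpha>)) c + s *\<^sub>R snd (f (p, \<beta>)) c))"

definition defines_poisson ::
  "('a, 'e::real_inner) atlas \<Rightarrow> ('a \<times> ('a, 'e) covec \<Rightarrow> 'a \<times> ('a, 'e) tvec) \<Rightarrow> bool" where
  "defines_poisson A f \<longleftrightarrow>
     (\<exists>P. poisson_bivector A P \<and> (\<forall>a\<in>points (cotangent A). f a = sharp A P a))"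


section \<open>Canonical structures\<close>

text \<open>
  \<open>\<Lambda>\<^sub>M = \<Sum>\<^sub>i \<partial>/\<partial>x\<^sup>i \<and> \<partial>/\<partial>p\<^sub>i\<close> in the canonical coordinates \<open>(x, p)\<close> on \<open>T\<^sup>*M\<close> induced by a chart
  of \<open>M\<close>; the value does not depend on the chart.
\<close>

definition wedge :: "('a, 'e) tvec \<Rightarrow> ('a, 'e) tvec \<Rightarrow> ('a, 'e) covec \<Rightarrow> ('a, 'e) covec \<Rightarrow> real" where
  "wedge X Y a b = a X * b Y - a Y * b X"

definition canonical_bivector ::
  "('a, 'e::real_inner) atlas \<Rightarrow> ('a \<times> ('a, 'e) covec, 'e \<times> 'e) bivec" where
  "canonical_bivector A q a b =
     (let C = cotangent_chart A (chart_at A (fst q)) in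
      \<Sum>i\<in>coord_basis.
        wedge (tvec_of (cotangent A) C q (i, 0)) (tvec_of (cotangent A) C q (0, i)) a b)"

text \<open>\<open>\<kappa>\<^sub>M\<close>, in the coordinates of \<open>TTM\<close> induced by any chart of \<open>M\<close>; again the value does not
  depend on the chart.\<close>

definition canonical_flip ::
  "('a, 'e::real_normed_vector) atlas \<Rightarrow>
     ('a \<times> ('a, 'e) tvec) \<times> ('a \<times> ('a, 'e) tvec, 'e \<times> 'e) tvec \<Rightarrow>
     ('a \<times> ('a, 'e) tvec) \<times> ('a \<times> ('a, 'e) tvec, 'e \<times> 'e) tvec" where
  "canonical_flip A V =
     (let C = tangent_chart (tangent A) (tangent_chart A (chart_at A (fst (fst V))));
          ((x, x'), (dx, dx')) = cmap C V
      in cinv C ((x, dx), (x', dx')))"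

text \<open>The manifold \<open>TM \<times>\<^sub>M T\<^sup>*M\<close> and the pairing on it.\<close>

definition pairing_bundle_chart ::
  "('a, 'e::real_inner) atlas \<Rightarrow> ('a, 'e) chart \<Rightarrow>
     (('a \<times> ('a, 'e) tvec) \<times> ('a \<times> ('a, 'e) covec), 'e \<times> 'e \<times> 'e) chart" where
  "pairing_bundle_chart A c =
     Chart {((p, v), (q, \<alpha>)). p = q \<and> p \<in> cdom c \<and> v \<in> tangent_space A p \<and> \<alpha> \<in> cotangent_space A p}
       (\<lambda>((p, v), (q, \<alpha>)). (cmap c p, v c, covec_comp A c q \<alpha>))"

definition pairing_bundle ::
  "('a, 'e::real_inner) atlas \<Rightarrow>
     (('a \<times> ('a, 'e) tvec) \<times> ('a \<times> ('a, 'e) covec), 'e \<times> 'e \<times> 'e) atlas" where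
  "pairing_bundle A = pairing_bundle_chart A ` A"

definition pairing :: "('a \<times> ('a, 'e) tvec) \<times> ('a \<times> ('a, 'e) covec) \<Rightarrow> real" where
  "pairing = (\<lambda>((p, v), (q, \<alpha>)). \<alpha> v)"

text \<open>
  \<open>\<langle>V, w\<rangle>'\<close> for \<open>V \<in> TTM\<close> and \<open>w \<in> TT\<^sup>*M\<close> over the same vector of \<open>TM\<close>: such a pair is identified
  with the tangent vector \<open>u\<close> of \<open>TM \<times>\<^sub>M T\<^sup>*M\<close> which projects to \<open>V\<close> and \<open>w\<close>.
\<close>

definition tangent_pairing ::
  "('a, 'e::real_inner) atlas \<Rightarrow>
     ('a \<times> ('a, 'e) tvec) \<times> ('a \<times> ('a, 'e) tvec, 'e \<times> 'e) tvec \<Rightarrow>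
     ('a \<times> ('a, 'e) covec) \<times> ('a \<times> ('a, 'e) covec, 'e \<times> 'e) tvec \<Rightarrow> real" where
  "tangent_pairing A V w =
     (let u = (THE u. u \<in> points (tangent (pairing_bundle A)) \<and>
                 tangent_map (pairing_bundle A) (tangent A) fst u = V \<and>
                 tangent_map (pairing_bundle A) (cotangent A) snd u = w)
      in snd (tangent_map (pairing_bundle A) real_line pairing u) (Chart UNIV (\<lambda>t. t)))"

definition alpha_map ::
  "('a, 'e::real_inner) atlas \<Rightarrow>
     ('a \<times> ('a, 'e) covec) \<times> ('a \<times> ('a, 'e) covec, 'e \<times> 'e) tvec \<Rightarrow>
     ('a \<times> ('a, 'e) tvec) \<times> ('a \<times> ('a, 'e) tvec, 'e \<times> 'e) covec" where
  "alpha_map A w =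
     (let y = tangent_map (cotangent A) A fst w
      in (y, \<lambda>v. if v \<in> tangent_space (tangent A) y
                 then tangent_pairing A (canonical_flip A (y, v)) w else 0))"

definition epsilon_map ::
  "('a, 'e::real_inner) atlas \<Rightarrow>
     ('a \<times> ('a, 'e) tvec) \<times> ('a \<times> ('a, 'e) tvec, 'e \<times> 'e) covec \<Rightarrow>
     ('a \<times> ('a, 'e) covec) \<times> ('a \<times> ('a, 'e) covec, 'e \<times> 'e) tvec" where
  "epsilon_map A = inv_into (points (tangent (cotangent A))) (alpha_map A)"

definition graph_on :: "'a set \<Rightarrow> ('a \<Rightarrow> 'b) \<Rightarrow> ('a \<times> 'b) set" where
  "graph_on S f = {(x, f x) | x. x \<in> S}"

end

theory Submission
  imports Defs
begin

text \<open>
  In a chart of $M$ a morphism is $\<lambda>(x, w) = (x, L_x w)$ with a linear map $L_x$. Let $D_w u$ be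
  the derivative of $x \<mapsto> L_x w$ in the direction $u$, and let $a$ be $(x, w)$ and $\<xi>$ have the
  components $(s, b)$ in the induced chart of $TM$. Then $\<xi> \<circ> T_a\<lambda>$ has the components $(s +
  D_w^T b, L^T b)$, contraction with $\<Lambda>_M$ turns them into $(-L^T b, s + D_w^T b)$, and $\<epsilon>_M(\<xi>)$
  is the vector $(L w, s)$ at $(x, b)$. Hence both sides of the equation are tangent vectors of
  $TM$ at $\<lambda>(a)$, with the components

    left: $(- L^T b, D_w(- L^T b) + L(s + D_w^T b))$, right: $(L b, D_b(L w) + L s)$

  (lemmas \<open>left_side_coords\<close> and \<open>right_side_coords\<close>). Equality of the first components says
  that $L$ is skew-symmetric, that is, $P(\<alpha>, \<beta>) = \<langle>\<beta>, \<lambda>(\<alpha>)\<rangle>$ is a bivector field, the only one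
  that can induce $\<lambda>$. If this holds at all points, it may be differentiated: $v \<cdot> D_w u = - w \<cdot>
  D_v u$. The difference of the second components, paired with an arbitrary $r$, then is minus
  the cyclic sum $w \<cdot> D_r(L b) + b \<cdot> D_w(L r) + r \<cdot> D_b(L w)$ (lemma \<open>jacobiator_eq_pairing\<close>),
  which is half the Schouten bracket $[P, P]$ on the covectors $b$, $r$, $w$ (lemma
  \<open>schouten_coords\<close>). So the equation holds everywhere if and only if $P$ is a Poisson bivector
  field.

  The equation of relations is the pointwise one: both relations consist of one pair for every
  $a$ and $\<xi>$, and on the right side this pair depends on $a$ through $\<lambda>(a)$ only.

  Most of the text establishes the coordinate expressions. Lemma \<open>tangent_map_in_charts\<close>
  computes a tangent map from one local expression of the map; with it, the maps $T\<lambda>$, $\<alpha>_M$ and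
  the derivative of the pairing reduce to derivatives of explicit functions.
\<close>

section \<open>Coordinates with respect to an orthonormal basis\<close>

lemma coord_expansion:
  assumes "finite_dimensional TYPE('e::real_inner)"
  shows "(\<Sum>i\<in>coord_basis. (w \<bullet> i) *\<^sub>R i) = (w :: 'e)"
proof -
  note B = coord_basis[OF assms]
  define r where "r = w - (\<Sum>i\<in>coord_basis. (w \<bullet> i) *\<^sub>R i)"
  have "orthogonal r j" if j: "j \<in> coord_basis" for j
  proof -
    have "(\<Sum>i\<in>coord_basis. (w \<bullet> i) * (i \<bullet> j)) = (\<Sum>i\<in>coord_basis. if i = j then w \<bullet> i else 0)"
    proof (rule sum.cong)
      fix i :: 'e assume i: "i \<in> coord_basis"
      show "(w \<bullet> i) * (i \<bullet> j) = (if i = j then w \<bullet> i else 0)"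
        using i j B(2,3) by (auto simp: pairwise_def orthogonal_def dot_square_norm)
    qed simp
    also have "\<dots> = w \<bullet> j"
      using j B(1) by simp
    finally show ?thesis
      by (simp add: r_def orthogonal_def inner_diff_left inner_sum_left)
  qed
  then have "orthogonal r r"
    using orthogonal_to_span[of r coord_basis r] B(4) by blast
  then show ?thesis
    by (simp add: orthogonal_def r_def)
qed

lemma coord_parseval:
  assumes "finite_dimensional TYPE('e::real_inner)"
  shows "(\<Sum>i\<in>coord_basis. (v \<bullet> i) * (w \<bullet> i)) = v \<bullet> (w :: 'e)"
proof -
  have "v \<bullet> w = v \<bullet> (\<Sum>i\<in>coord_basis. (w \<bullet> i) *\<^sub>R i)"
    by (simp add: coord_expansion[OF assms])
  then show ?thesis
    by (simp add: inner_sum_right mult.commute)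
qed

lemma linear_form_eq_inner:
  fixes \<phi> :: "'e::real_inner \<Rightarrow> real"
  assumes "finite_dimensional TYPE('e)" and "linear \<phi>"
  shows "\<phi> u = (\<Sum>i\<in>coord_basis. \<phi> i *\<^sub>R i) \<bullet> u"
proof -
  have "\<phi> u = \<phi> (\<Sum>i\<in>coord_basis. (u \<bullet> i) *\<^sub>R i)"
    by (simp add: coord_expansion[OF assms(1)])
  also have "\<dots> = (\<Sum>i\<in>coord_basis. (u \<bullet> i) * \<phi> i)"
    by (simp add: linear_sum[OF assms(2)] linear_scale[OF assms(2)])
  also have "\<dots> = (\<Sum>i\<in>coord_basis. \<phi> i *\<^sub>R i) \<bullet> u"
    by (simp add: inner_sum_left inner_commute[of u] mult.commute)
  finally show ?thesis .
qed

lemma finite_dimensional_prod: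
  assumes "finite_dimensional TYPE('e::real_vector)" and "finite_dimensional TYPE('f::real_vector)"
  shows "finite_dimensional TYPE('e \<times> 'f)"
proof -
  obtain B :: "'e set" where B: "finite B" "span B = UNIV"
    using assms(1) unfolding finite_dimensional_def by blast
  obtain C :: "'f set" where C: "finite C" "span C = UNIV"
    using assms(2) unfolding finite_dimensional_def by blast
  let ?D = "(\<lambda>x. (x, 0)) ` B \<union> (\<lambda>y. (0, y)) ` C :: ('e \<times> 'f) set"
  have lin: "linear (\<lambda>x::'e. (x, 0::'f))" "linear (\<lambda>y::'f. (0::'e, y))"
    by (auto intro!: linearI)
  have "z \<in> span ?D" for z :: "'e \<times> 'f"
  proof -
    have "(fst z, 0) \<in> span ((\<lambda>x. (x, 0::'f)) ` B)" "(0, snd z) \<in> span ((\<lambda>y. (0::'e, y)) ` C)"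
      unfolding linear_span_image[OF lin(1)] linear_span_image[OF lin(2)] B C by auto
    then have "(fst z, 0) + (0, snd z) \<in> span ?D"
      by (intro span_add) (meson span_mono subsetD sup_ge1 sup_ge2)+
    then show ?thesis
      by simp
  qed
  then show ?thesis
    unfolding finite_dimensional_def using B(1) C(1) by (intro exI[of _ ?D]) auto
qed

section \<open>Atlases with differentiable transition maps\<close>

text \<open>Tangent spaces and tangent maps involve only the first derivatives of transition maps. The
  transition maps of $TM$ and $T^*M$ contain the first derivatives of those of $M$, so for the
  bundles this weaker notion follows from two derivatives on $M$; and it is all that the tangent
  and cotangent spaces of $TM$ and $T^*M$ require.\<close>

locale differentiable_atlas =
  fixes A :: "('a, 'e::real_normed_vector) atlas"
  assumes inj_chart: "c \<in> A \<Longrightarrow> inj_on (cmap c) (cdom c)"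
    and open_overlap: "c \<in> A \<Longrightarrow> d \<in> A \<Longrightarrow> open (cmap c ` (cdom c \<inter> cdom d))"
    and differentiable_transition: "c \<in> A \<Longrightarrow> d \<in> A \<Longrightarrow> p \<in> cdom c \<Longrightarrow> p \<in> cdom d \<Longrightarrow>
      (cmap d \<circ> cinv c) differentiable at (cmap c p)"
begin

lemma cinv_cmap: "c \<in> A \<Longrightarrow> p \<in> cdom c \<Longrightarrow> cinv c (cmap c p) = p"
  unfolding cinv_def by (simp add: inj_chart)

lemma open_chart: "c \<in> A \<Longrightarrow> open (cmap c ` cdom c)"
  using open_overlap[of c c] by simp

lemma transition_has_derivative:
  assumes "c \<in> A" "d \<in> A" "p \<in> cdom c" "p \<in> cdom d"
  shows "((cmap d \<circ> cinv c) has_derivative frechet_derivative (cmap d \<circ> cinv c) (at (cmap c p)))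
    (at (cmap c p))"
  using differentiable_transition[OF assms] frechet_derivative_works by blast

lemma linear_transition:
  assumes "c \<in> A" "d \<in> A" "p \<in> cdom c" "p \<in> cdom d"
  shows "linear (frechet_derivative (cmap d \<circ> cinv c) (at (cmap c p)))"
  using transition_has_derivative[OF assms] has_derivative_linear by blast

lemma transition_refl:
  assumes "c \<in> A" "p \<in> cdom c"
  shows "frechet_derivative (cmap c \<circ> cinv c) (at (cmap c p)) u = u"
proof -
  have "((cmap c \<circ> cinv c) has_derivative (\<lambda>u. u)) (at (cmap c p))"
    by (rule has_derivative_transform_within_open[OF has_derivative_ident open_chart[OF assms(1)]])
      (use assms in \<open>auto simp: cinv_cmap\<close>)
  then show ?thesis
    using frechet_derivative_at by metis
qed

text \<open>The cocycle property is what makes the family of components in \<open>tvec_of\<close> obey the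
  transformation law between any two charts, not only between $c$ and another one.\<close>

lemma transition_cocycle:
  assumes "c \<in> A" "d \<in> A" "e \<in> A" "p \<in> cdom c" "p \<in> cdom d" "p \<in> cdom e"
  shows "frechet_derivative (cmap e \<circ> cinv c) (at (cmap c p)) u =
    frechet_derivative (cmap e \<circ> cinv d) (at (cmap d p))
      (frechet_derivative (cmap d \<circ> cinv c) (at (cmap c p)) u)"
proof -
  let ?f = "frechet_derivative (cmap d \<circ> cinv c) (at (cmap c p))"
  let ?g = "frechet_derivative (cmap e \<circ> cinv d) (at (cmap d p))"
  have "((cmap e \<circ> cinv d) has_derivative ?g) (at ((cmap d \<circ> cinv c) (cmap c p)))"
    using transition_has_derivative[of d e p] assms by (simp add: cinv_cmap)
  then have "((cmap e \<circ> cinv d) \<circ> (cmap d \<circ> cinv c) has_derivative ?g \<circ> ?f) (at (cmap c p))"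
    using transition_has_derivative[of c d p] assms by (intro diff_chain_at) auto
  then have "((cmap e \<circ> cinv c) has_derivative ?g \<circ> ?f) (at (cmap c p))"
    by (rule has_derivative_transform_within_open[OF _ open_overlap[of c d]])
      (use assms in \<open>auto simp: cinv_cmap\<close>)
  then show ?thesis
    using frechet_derivative_at by (metis comp_apply)
qed

lemma tangent_space_transition:
  assumes "v \<in> tangent_space A p" "c \<in> A" "d \<in> A" "p \<in> cdom c" "p \<in> cdom d"
  shows "v d = frechet_derivative (cmap d \<circ> cinv c) (at (cmap c p)) (v c)"
  using assms unfolding tangent_space_def by blast

lemma tangent_space_outside:
  assumes "v \<in> tangent_space A p" "\<not> (d \<in> A \<and> p \<in> cdom d)"
  shows "v d = 0"
  using assms unfolding tangent_space_def by blast

lemma tvec_of_chart: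
  assumes "c \<in> A" "p \<in> cdom c"
  shows "tvec_of A c p u c = u"
  using assms by (simp add: tvec_of_def transition_refl)

lemma tvec_of_in:
  assumes "c \<in> A" "p \<in> cdom c"
  shows "tvec_of A c p u \<in> tangent_space A p"
  unfolding tangent_space_def
proof (intro CollectI conjI ballI impI)
  fix d e
  assume "d \<in> A" "e \<in> A" "p \<in> cdom d \<and> p \<in> cdom e"
  then show "tvec_of A c p u e = frechet_derivative (cmap e \<circ> cinv d) (at (cmap d p)) (tvec_of A c p u d)"
    using transition_cocycle[of c d e p u] assms by (simp add: tvec_of_def)
qed (auto simp: tvec_of_def)

lemma tvec_of_component:
  assumes "c \<in> A" "p \<in> cdom c" "v \<in> tangent_space A p"
  shows "tvec_of A c p (v c) = v"
proof
  fix d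
  show "tvec_of A c p (v c) d = v d"
    using tangent_space_transition[OF assms(3,1), of d] assms(2) tangent_space_outside[OF assms(3)]
    by (cases "d \<in> A \<and> p \<in> cdom d") (auto simp: tvec_of_def)
qed

lemma tvec_eqI:
  assumes "c \<in> A" "p \<in> cdom c" "v \<in> tangent_space A p" "w \<in> tangent_space A p" "v c = w c"
  shows "v = w"
  using tvec_of_component assms by metis

lemma tangent_space_comb:
  assumes "v \<in> tangent_space A p" "w \<in> tangent_space A p"
  shows "(\<lambda>c. r *\<^sub>R v c + s *\<^sub>R w c) \<in> tangent_space A p"
  unfolding tangent_space_def
proof (intro CollectI conjI ballI impI allI)
  fix c d
  assume *: "c \<in> A" "d \<in> A" "p \<in> cdom c \<and> p \<in> cdom d"
  then have "linear (frechet_derivative (cmap d \<circ> cinv c) (at (cmap c p)))"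
    by (intro linear_transition) auto
  then show "r *\<^sub>R v d + s *\<^sub>R w d =
      frechet_derivative (cmap d \<circ> cinv c) (at (cmap c p)) (r *\<^sub>R v c + s *\<^sub>R w c)"
    using tangent_space_transition[OF assms(1) *(1,2)] tangent_space_transition[OF assms(2) *(1,2)] *(3)
    by (simp only: linear_add linear_scale)
qed (simp add: tangent_space_outside[OF assms(1)] tangent_space_outside[OF assms(2)])

lemma tvec_of_comb:
  assumes "c \<in> A" "p \<in> cdom c"
  shows "tvec_of A c p (r *\<^sub>R u + s *\<^sub>R v) = (\<lambda>d. r *\<^sub>R tvec_of A c p u d + s *\<^sub>R tvec_of A c p v d)"
  by (rule tvec_eqI[OF assms]) (simp_all add: assms tvec_of_in tangent_space_comb tvec_of_chart)

lemma chart_at: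
  assumes "p \<in> points A"
  shows "chart_at A p \<in> A" "p \<in> cdom (chart_at A p)"
proof -
  have "\<exists>c. c \<in> A \<and> p \<in> cdom c"
    using assms by (auto simp: points_def)
  then have "chart_at A p \<in> A \<and> p \<in> cdom (chart_at A p)"
    unfolding chart_at_def by (rule someI_ex)
  then show "chart_at A p \<in> A" "p \<in> cdom (chart_at A p)"
    by auto
qed

lemma cdom_tangent_chart: "cdom (tangent_chart A c) = (SIGMA p:cdom c. tangent_space A p)"
  by (simp add: tangent_chart_def)

lemma cmap_tangent_chart: "cmap (tangent_chart A c) (p, v) = (cmap c p, v c)"
  by (simp add: tangent_chart_def)

lemma points_tangent: "points (tangent A) = (SIGMA p:points A. tangent_space A p)"
  by (auto simp: points_def tangent_def cdom_tangent_chart)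

lemma inj_tangent_chart:
  assumes "c \<in> A"
  shows "inj_on (cmap (tangent_chart A c)) (cdom (tangent_chart A c))"
proof (rule inj_onI, clarsimp simp: cdom_tangent_chart cmap_tangent_chart)
  fix p v q w
  assume *: "p \<in> cdom c" "v \<in> tangent_space A p" "q \<in> cdom c" "w \<in> tangent_space A q"
    "cmap c p = cmap c q" "v c = w c"
  then have "p = q"
    using inj_chart[OF assms] by (auto dest: inj_onD)
  then show "p = q \<and> v = w"
    using * tvec_eqI[OF assms] by blast
qed

lemma cinv_tangent_chart:
  assumes "c \<in> A" "p \<in> cdom c"
  shows "cinv (tangent_chart A c) (cmap c p, u) = (p, tvec_of A c p u)"
proof -
  have "cmap (tangent_chart A c) (p, tvec_of A c p u) = (cmap c p, u)"
    by (simp add: cmap_tangent_chart tvec_of_chart assms)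
  moreover have "(p, tvec_of A c p u) \<in> cdom (tangent_chart A c)"
    by (simp add: cdom_tangent_chart tvec_of_in assms)
  ultimately show ?thesis
    unfolding cinv_def using inj_tangent_chart[OF assms(1)] by (metis inv_into_f_f)
qed

end

text \<open>The tangent map is defined with an arbitrarily chosen chart at the source and evaluated in
  all charts at the target. By the chain rule it is enough to know the derivative of one local
  expression $g$ of $f$, in any pair of charts such that $f$ maps the one into the other.\<close>

lemma tangent_map_in_charts:
  fixes A :: "('a, 'e::real_normed_vector) atlas" and B :: "('b, 'f::real_normed_vector) atlas"
  assumes "differentiable_atlas A" and "differentiable_atlas B"
    and c: "c \<in> A" "p \<in> cdom c" and d: "d \<in> B"
    and f: "\<And>q. q \<in> cdom c \<Longrightarrow> f q \<in> cdom d \<and> cmap d (f q) = g (cmap c q)"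
    and g: "(g has_derivative g') (at (cmap c p))"
    and v: "v \<in> tangent_space A p"
  shows "tangent_map A B f (p, v) = (f p, tvec_of B d (f p) (g' (v c)))"
proof -
  interpret A: differentiable_atlas A by fact
  interpret B: differentiable_atlas B by fact
  define b where "b = chart_at A p"
  have b: "b \<in> A" "p \<in> cdom b"
    using A.chart_at[of p] c by (auto simp: points_def b_def)
  have "frechet_derivative (cmap e \<circ> f \<circ> cinv b) (at (cmap b p)) (v b) =
      frechet_derivative (cmap e \<circ> cinv d) (at (cmap d (f p))) (g' (v c))"
    if e: "e \<in> B" "f p \<in> cdom e" for e
  proof -
    let ?s = "frechet_derivative (cmap c \<circ> cinv b) (at (cmap b p))"
    let ?t = "frechet_derivative (cmap e \<circ> cinv d) (at (cmap d (f p)))"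
    have "(g \<circ> (cmap c \<circ> cinv b) has_derivative g' \<circ> ?s) (at (cmap b p))"
      using A.transition_has_derivative[of b c p] b c g by (intro diff_chain_at) (auto simp: A.cinv_cmap)
    moreover have "((cmap e \<circ> cinv d) has_derivative ?t) (at ((g \<circ> (cmap c \<circ> cinv b)) (cmap b p)))"
      using B.transition_has_derivative[of d e "f p"] d e f[OF c(2)] b by (simp add: A.cinv_cmap)
    ultimately have "((cmap e \<circ> cinv d) \<circ> (g \<circ> (cmap c \<circ> cinv b)) has_derivative ?t \<circ> (g' \<circ> ?s)) (at (cmap b p))"
      by (rule diff_chain_at)
    then have "((cmap e \<circ> f \<circ> cinv b) has_derivative ?t \<circ> (g' \<circ> ?s)) (at (cmap b p))"
    proof (rule has_derivative_transform_within_open[OF _ A.open_overlap[OF b(1) c(1)]])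
      fix x assume "x \<in> cmap b ` (cdom b \<inter> cdom c)"
      then obtain q where q: "q \<in> cdom b" "q \<in> cdom c" "x = cmap b q"
        by auto
      then show "((cmap e \<circ> cinv d) \<circ> (g \<circ> (cmap c \<circ> cinv b))) x = (cmap e \<circ> f \<circ> cinv b) x"
        using f[of q] b(1) B.cinv_cmap[OF d, of "f q"] by (simp add: A.cinv_cmap)
    qed (use b c in auto)
    then have "frechet_derivative (cmap e \<circ> f \<circ> cinv b) (at (cmap b p)) = ?t \<circ> (g' \<circ> ?s)"
      using frechet_derivative_at by metis
    moreover have "?s (v b) = v c"
      using A.tangent_space_transition[OF v b(1) c(1) b(2) c(2)] by (rule sym)
    ultimately show ?thesis
      by simp
  qed
  then show ?thesis
    by (auto simp: tangent_map_def tvec_of_def b_def Let_def fun_eq_iff)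
qed

text \<open>The atlases of $TM$, $T^*M$ and the fibre product $TM \<times>_M T^*M$ have one chart for each
  chart of the base, and their transition maps \<open>F\<close> are known in closed form; the criterion
  avoids the inverse charts.\<close>

lemma differentiable_atlas_image:
  assumes "\<And>c. c \<in> A \<Longrightarrow> inj_on (cmap (C c)) (cdom (C c))"
    and "\<And>c d. c \<in> A \<Longrightarrow> d \<in> A \<Longrightarrow> open (cmap (C c) ` (cdom (C c) \<inter> cdom (C d)))"
    and "\<And>c d q. c \<in> A \<Longrightarrow> d \<in> A \<Longrightarrow> q \<in> cdom (C c) \<Longrightarrow> q \<in> cdom (C d) \<Longrightarrow>
      cmap (C d) q = F c d (cmap (C c) q)"
    and "\<And>c d q. c \<in> A \<Longrightarrow> d \<in> A \<Longrightarrow> q \<in> cdom (C c) \<Longrightarrow> q \<in> cdom (C d) \<Longrightarrow>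
      F c d differentiable at (cmap (C c) q)"
  shows "differentiable_atlas (C ` A)"
proof
  fix c d p
  assume "c \<in> C ` A" "d \<in> C ` A" and p: "p \<in> cdom c" "p \<in> cdom d"
  then obtain a b where ab: "a \<in> A" "b \<in> A" "c = C a" "d = C b"
    by auto
  obtain F' where "(F a b has_derivative F') (at (cmap c p))"
    using assms(4)[of a b p] ab p by (auto simp: differentiable_def)
  then have "((cmap d \<circ> cinv c) has_derivative F') (at (cmap c p))"
  proof (rule has_derivative_transform_within_open[OF _ assms(2)[OF ab(1,2)]])
    fix x assume "x \<in> cmap (C a) ` (cdom (C a) \<inter> cdom (C b))"
    then obtain q where q: "q \<in> cdom (C a)" "q \<in> cdom (C b)" "x = cmap (C a) q"
      by auto
    then have "cinv (C a) x = q"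
      using assms(1)[OF ab(1)] by (simp add: cinv_def)
    then show "F a b x = (cmap d \<circ> cinv c) x"
      using assms(3)[OF ab(1,2) q(1,2)] ab q(3) by simp
  qed (use ab p in auto)
  then show "(cmap d \<circ> cinv c) differentiable at (cmap c p)"
    by (auto simp: differentiable_def)
qed (use assms(1,2) in auto)

section \<open>Covectors in coordinates\<close>

locale coordinate_atlas = differentiable_atlas A
  for A :: "('a, 'e::real_inner) atlas" +
  assumes finite_dim: "finite_dimensional TYPE('e)"
begin

lemma covec_of_in: "covec_of A c p w \<in> cotangent_space A p"
  unfolding cotangent_space_def covec_of_def
  by (auto simp: tangent_space_comb inner_add_right)

lemma covec_of_apply: "v \<in> tangent_space A p \<Longrightarrow> covec_of A c p w v = w \<bullet> v c"
  by (simp add: covec_of_def)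

lemma covec_comp_of:
  assumes "c \<in> A" "p \<in> cdom c"
  shows "covec_comp A c p (covec_of A c p w) = w"
  using assms
  by (simp add: covec_comp_def covec_of_apply tvec_of_in tvec_of_chart coord_expansion finite_dim)

lemma covec_of_comp:
  assumes c: "c \<in> A" "p \<in> cdom c" and \<alpha>: "\<alpha> \<in> cotangent_space A p"
  shows "covec_of A c p (covec_comp A c p \<alpha>) = \<alpha>"
proof
  fix v
  have comb: "\<alpha> (tvec_of A c p (r *\<^sub>R u + s *\<^sub>R w)) = r * \<alpha> (tvec_of A c p u) + s * \<alpha> (tvec_of A c p w)"
    for r s u w
    unfolding tvec_of_comb[OF c]
    using \<alpha> tvec_of_in[OF c, of u] tvec_of_in[OF c, of w] unfolding cotangent_space_def by blast
  have lin: "linear (\<lambda>u. \<alpha> (tvec_of A c p u))"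
  proof (rule linearI)
    fix u w r
    show "\<alpha> (tvec_of A c p (u + w)) = \<alpha> (tvec_of A c p u) + \<alpha> (tvec_of A c p w)"
      using comb[of 1 u 1 w] by simp
    show "\<alpha> (tvec_of A c p (r *\<^sub>R u)) = r *\<^sub>R \<alpha> (tvec_of A c p u)"
      using comb[of r u 0 u] by simp
  qed
  show "covec_of A c p (covec_comp A c p \<alpha>) v = \<alpha> v"
  proof (cases "v \<in> tangent_space A p")
    case True
    then have "\<alpha> v = \<alpha> (tvec_of A c p (v c))"
      by (simp add: tvec_of_component c)
    also have "\<dots> = covec_comp A c p \<alpha> \<bullet> v c"
      unfolding covec_comp_def by (rule linear_form_eq_inner[OF finite_dim lin])
    finally show ?thesis
      using True by (simp add: covec_of_apply)
  next
    case False
    then show ?thesis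
      using \<alpha> by (simp add: covec_of_def cotangent_space_def)
  qed
qed

lemma covec_apply:
  assumes "c \<in> A" "p \<in> cdom c" "\<alpha> \<in> cotangent_space A p" "v \<in> tangent_space A p"
  shows "\<alpha> v = covec_comp A c p \<alpha> \<bullet> v c"
  using covec_of_comp[OF assms(1-3)] covec_of_apply[OF assms(4), of c "covec_comp A c p \<alpha>"] by simp

lemma covec_of_comb:
  "covec_of A c p (r *\<^sub>R u + s *\<^sub>R v) = (\<lambda>t. r * covec_of A c p u t + s * covec_of A c p v t)"
  by (auto simp: covec_of_def inner_add_left fun_eq_iff)

lemma cdom_cotangent_chart: "cdom (cotangent_chart A c) = (SIGMA p:cdom c. cotangent_space A p)"
  by (simp add: cotangent_chart_def)

lemma cmap_cotangent_chart: "cmap (cotangent_chart A c) (p, \<alpha>) = (cmap c p, covec_comp A c p \<alpha>)"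
  by (simp add: cotangent_chart_def)

lemma points_cotangent: "points (cotangent A) = (SIGMA p:points A. cotangent_space A p)"
  by (auto simp: points_def cotangent_def cdom_cotangent_chart)

lemma inj_cotangent_chart:
  assumes "c \<in> A"
  shows "inj_on (cmap (cotangent_chart A c)) (cdom (cotangent_chart A c))"
proof (rule inj_onI, clarsimp simp: cdom_cotangent_chart cmap_cotangent_chart)
  fix p \<alpha> q \<beta>
  assume *: "p \<in> cdom c" "\<alpha> \<in> cotangent_space A p" "q \<in> cdom c" "\<beta> \<in> cotangent_space A q"
    "cmap c p = cmap c q" "covec_comp A c p \<alpha> = covec_comp A c q \<beta>"
  then have "p = q"
    using inj_chart[OF assms] by (auto dest: inj_onD)
  then show "p = q \<and> \<alpha> = \<beta>"
    using * covec_of_comp[OF assms] by metis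
qed

lemma cinv_cotangent_chart:
  assumes "c \<in> A" "p \<in> cdom c"
  shows "cinv (cotangent_chart A c) (cmap c p, w) = (p, covec_of A c p w)"
proof -
  have "cmap (cotangent_chart A c) (p, covec_of A c p w) = (cmap c p, w)"
    by (simp add: cmap_cotangent_chart covec_comp_of assms)
  moreover have "(p, covec_of A c p w) \<in> cdom (cotangent_chart A c)"
    by (simp add: cdom_cotangent_chart covec_of_in assms)
  ultimately show ?thesis
    unfolding cinv_def using inj_cotangent_chart[OF assms(1)] by (metis inv_into_f_f)
qed

text \<open>Covectors separate tangent vectors, so the pairings determine the contraction.\<close>

lemma sharp_eqI:
  assumes p: "p \<in> points A" and v: "v \<in> tangent_space A p"
    and P: "\<And>\<beta>. \<beta> \<in> cotangent_space A p \<Longrightarrow> \<beta> v = P p \<alpha> \<beta>"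
  shows "sharp A P (p, \<alpha>) = (p, v)"
proof -
  define c where "c = chart_at A p"
  have c: "c \<in> A" "p \<in> cdom c"
    using chart_at[OF p] by (auto simp: c_def)
  have "u = v" if u: "u \<in> tangent_space A p" "\<forall>\<beta>\<in>cotangent_space A p. \<beta> u = P p \<alpha> \<beta>" for u
  proof -
    have "covec_of A c p (u c - v c) u = covec_of A c p (u c - v c) v"
      using P[OF covec_of_in] u(2) covec_of_in by metis
    then have "(u c - v c) \<bullet> (u c - v c) = 0"
      using u(1) v by (simp add: covec_of_apply inner_diff_right)
    then have "u c = v c"
      by simp
    then show ?thesis
      by (rule tvec_eqI[OF c u(1) v])
  qed
  then have "(THE u. u \<in> tangent_space A p \<and> (\<forall>\<beta>\<in>cotangent_space A p. \<beta> u = P p \<alpha> \<beta>)) = v"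
    using v P by (intro the_equality conjI ballI) blast+
  then show ?thesis
    by (simp add: sharp_def)
qed

text \<open>The form $P(\<alpha>, -)$ on the cotangent space is the evaluation at a tangent vector, by finite
  dimension; so the definite description in \<open>sharp\<close> has a value and that value has the pairings
  prescribed by $P$.\<close>

lemma bivector_sharp:
  assumes P: "bivector_field A P" and p: "p \<in> points A"
    and \<alpha>: "\<alpha> \<in> cotangent_space A p" and \<beta>: "\<beta> \<in> cotangent_space A p"
  shows "\<beta> (snd (sharp A P (p, \<alpha>))) = P p \<alpha> \<beta>"
proof -
  define c where "c = chart_at A p"
  have c: "c \<in> A" "p \<in> cdom c"
    using chart_at[OF p] by (auto simp: c_def)
  have comb: "P p \<alpha> (covec_of A c p (r *\<^sub>R u + s *\<^sub>R w)) =
      r * P p \<alpha> (covec_of A c p u) + s * P p \<alpha> (covec_of A c p w)" for r s u w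
    using P p \<alpha> covec_of_in unfolding bivector_field_def covec_of_comb by blast
  have lin: "linear (\<lambda>w. P p \<alpha> (covec_of A c p w))"
  proof (rule linearI)
    fix u w r
    show "P p \<alpha> (covec_of A c p (u + w)) = P p \<alpha> (covec_of A c p u) + P p \<alpha> (covec_of A c p w)"
      using comb[of 1 u 1 w] by simp
    show "P p \<alpha> (covec_of A c p (r *\<^sub>R u)) = r *\<^sub>R P p \<alpha> (covec_of A c p u)"
      using comb[of r u 0 u] by simp
  qed
  define u where "u = (\<Sum>i\<in>coord_basis. P p \<alpha> (covec_of A c p i) *\<^sub>R i)"
  have "\<gamma> (tvec_of A c p u) = P p \<alpha> \<gamma>" if \<gamma>: "\<gamma> \<in> cotangent_space A p" for \<gamma>
    using linear_form_eq_inner[OF finite_dim lin, of "covec_comp A c p \<gamma>"] covec_of_comp[OF c \<gamma>]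
      covec_apply[OF c \<gamma> tvec_of_in[OF c, of u]]
    by (simp add: u_def tvec_of_chart c inner_commute)
  then show ?thesis
    using sharp_eqI[OF p tvec_of_in[OF c], of u P \<alpha>] \<beta> by simp
qed

end

section \<open>The bundles over a manifold as atlases\<close>

lemma smooth_on_differentiable:
  "smooth_on S f \<Longrightarrow> x \<in> S \<Longrightarrow> f differentiable (at x)"
  unfolding smooth_on_def using Ck_on.simps(2) by blast

lemma smooth_on_derivative:
  "smooth_on S f \<Longrightarrow> smooth_on S (\<lambda>x. frechet_derivative f (at x) v)"
  unfolding smooth_on_def using Ck_on.simps(2) by blast

lemma differentiable_compose_fst:
  "f differentiable (at x) \<Longrightarrow> (\<lambda>z. f (fst z)) differentiable (at (x, u))"
  by (rule differentiable_compose[of f fst])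
    (auto intro: bounded_linear_imp_differentiable bounded_linear_fst)

text \<open>Smoothness only provides the derivative in each fixed direction as a smooth function of
  the point; expanding the direction in a basis gives joint differentiability.\<close>

lemma differentiable_frechet_derivative_pair:
  fixes f :: "'e::real_inner \<Rightarrow> 'f::real_normed_vector"
  assumes fd: "finite_dimensional TYPE('e)" and S: "open S" "x \<in> S" and f: "smooth_on S f"
  shows "(\<lambda>(x, u). frechet_derivative f (at x) u) differentiable (at (x, u))"
proof -
  let ?g = "\<lambda>z. \<Sum>i\<in>coord_basis. (snd z \<bullet> i) *\<^sub>R frechet_derivative f (at (fst z)) i"
  have "(\<lambda>z. frechet_derivative f (at (fst z)) i) differentiable (at (x, u))" for i
    using smooth_on_differentiable[OF smooth_on_derivative[OF f, of i] S(2)]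
    by (rule differentiable_compose_fst)
  moreover have "(\<lambda>z::'e \<times> 'e. snd z \<bullet> i) differentiable (at (x, u))" for i
    by (intro bounded_linear_imp_differentiable bounded_linear_intros)
  ultimately have "?g differentiable (at (x, u))"
    using coord_basis(1)[OF fd] by (intro differentiable_sum differentiable_scaleR ballI) auto
  then obtain g' where "(?g has_derivative g') (at (x, u))"
    by (auto simp: differentiable_def)
  then have "((\<lambda>(x, u). frechet_derivative f (at x) u) has_derivative g') (at (x, u))"
  proof (rule has_derivative_transform_within_open)
    show "open (S \<times> (UNIV :: 'e set))"
      using S(1) by (simp add: open_Times)
    fix z :: "'e \<times> 'e" assume "z \<in> S \<times> UNIV"
    then have "f differentiable (at (fst z))"
      using smooth_on_differentiable[OF f] by auto
    then have lin: "linear (frechet_derivative f (at (fst z)))"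
      by (rule linear_frechet_derivative)
    have "frechet_derivative f (at (fst z)) (snd z) =
        frechet_derivative f (at (fst z)) (\<Sum>i\<in>coord_basis. (snd z \<bullet> i) *\<^sub>R i)"
      by (simp add: coord_expansion[OF fd])
    then show "?g z = (case z of (x, u) \<Rightarrow> frechet_derivative f (at x) u)"
      by (simp add: linear_sum[OF lin] linear_scale[OF lin] split_def)
  qed (use S in simp)
  then show ?thesis
    by (auto simp: differentiable_def)
qed

locale manifold =
  fixes M :: "('a, 'e::real_inner) atlas"
  assumes smooth_manifold: "smooth_manifold M"
begin

sublocale coordinate_atlas M
proof
  show "finite_dimensional TYPE('e)"
    using smooth_manifold by (simp add: smooth_manifold_def)
  show "inj_on (cmap c) (cdom c)" if "c \<in> M" for c
    using smooth_manifold that by (simp add: smooth_manifold_def smooth_atlas_def)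
  fix c d assume cd: "c \<in> M" "d \<in> M"
  then have *: "open (cmap c ` (cdom c \<inter> cdom d)) \<and> smooth_on (cmap c ` (cdom c \<inter> cdom d)) (cmap d \<circ> cinv c)"
    using smooth_manifold by (simp add: smooth_manifold_def smooth_atlas_def)
  then show "open (cmap c ` (cdom c \<inter> cdom d))"
    by simp
  fix p assume "p \<in> cdom c" "p \<in> cdom d"
  with * show "cmap d \<circ> cinv c differentiable at (cmap c p)"
    using smooth_on_differentiable by blast
qed

lemma smooth_transition:
  "c \<in> M \<Longrightarrow> d \<in> M \<Longrightarrow> smooth_on (cmap c ` (cdom c \<inter> cdom d)) (cmap d \<circ> cinv c)"
  using smooth_manifold by (simp add: smooth_manifold_def smooth_atlas_def)

text \<open>The components of a covector transform with the transpose of the derivative of the inverse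
  transition; it is written out in the basis so that its differentiability is that of the
  derivatives in the basis directions.\<close>

definition covec_transition :: "('a, 'e) chart \<Rightarrow> ('a, 'e) chart \<Rightarrow> 'e \<times> 'e \<Rightarrow> 'e" where
  "covec_transition c d = (\<lambda>(x, w). \<Sum>i\<in>coord_basis.
     (w \<bullet> frechet_derivative (cmap c \<circ> cinv d) (at ((cmap d \<circ> cinv c) x)) i) *\<^sub>R i)"

lemma covec_comp_transition:
  assumes "c \<in> M" "d \<in> M" "p \<in> cdom c" "p \<in> cdom d" "\<alpha> \<in> cotangent_space M p"
  shows "covec_comp M d p \<alpha> = covec_transition c d (cmap c p, covec_comp M c p \<alpha>)"
proof -
  have "\<alpha> (tvec_of M d p i) =
      covec_comp M c p \<alpha> \<bullet> frechet_derivative (cmap c \<circ> cinv d) (at (cmap d p)) i" for i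
    using covec_apply[OF assms(1,3,5) tvec_of_in[OF assms(2,4)], of i] assms(1,3) by (simp add: tvec_of_def)
  then show ?thesis
    using assms by (simp add: covec_comp_def[of M d] covec_transition_def cinv_cmap)
qed

lemma differentiable_covec_transition:
  assumes "c \<in> M" "d \<in> M" "p \<in> cdom c" "p \<in> cdom d"
  shows "covec_transition c d differentiable at (cmap c p, w)"
proof -
  have \<tau>: "(cmap d \<circ> cinv c) differentiable at (cmap c p)"
    using differentiable_transition assms by blast
  have "(\<lambda>x. frechet_derivative (cmap c \<circ> cinv d) (at x) i) differentiable at ((cmap d \<circ> cinv c) (cmap c p))" for i
    using smooth_on_differentiable[OF smooth_on_derivative[OF smooth_transition[OF assms(2,1)]], of "cmap d p"] assms
    by (simp add: cinv_cmap)
  then have "(\<lambda>x. frechet_derivative (cmap c \<circ> cinv d) (at ((cmap d \<circ> cinv c) x)) i) differentiable at (cmap c p)" for i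
    using differentiable_compose[OF _ \<tau>] by blast
  then have "(\<lambda>z. frechet_derivative (cmap c \<circ> cinv d) (at ((cmap d \<circ> cinv c) (fst z))) i) differentiable at (cmap c p, w)" for i
    by (rule differentiable_compose_fst)
  moreover have "(snd :: 'e \<times> 'e \<Rightarrow> 'e) differentiable at (cmap c p, w)"
    by (intro bounded_linear_imp_differentiable bounded_linear_snd)
  ultimately show ?thesis
    unfolding covec_transition_def split_def using coord_basis(1)[OF finite_dim]
    by (intro differentiable_sum differentiable_scaleR differentiable_inner differentiable_const ballI) auto
qed

lemma differentiable_transition_fst:
  assumes "c \<in> M" "d \<in> M" "p \<in> cdom c" "p \<in> cdom d"
  shows "(\<lambda>z. (cmap d \<circ> cinv c) (fst z)) differentiable at (cmap c p, u)"
  using differentiable_transition[OF assms]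
  by (rule differentiable_compose_fst)

lemma differentiable_tangent_transition:
  assumes "c \<in> M" "d \<in> M" "p \<in> cdom c" "p \<in> cdom d"
  shows "(\<lambda>(x, u). frechet_derivative (cmap d \<circ> cinv c) (at x) u) differentiable at (cmap c p, u)"
  using assms
  by (intro differentiable_frechet_derivative_pair[OF finite_dim open_overlap[of c d] _ smooth_transition]) auto

lemma tangent_chart_image:
  assumes "c \<in> M"
  shows "cmap (tangent_chart M c) ` (cdom (tangent_chart M c) \<inter> cdom (tangent_chart M d)) =
    cmap c ` (cdom c \<inter> cdom d) \<times> UNIV"
proof (intro equalityI subsetI)
  fix z assume "z \<in> cmap c ` (cdom c \<inter> cdom d) \<times> (UNIV :: 'e set)"
  then obtain p u where p: "p \<in> cdom c" "p \<in> cdom d" "z = (cmap c p, u)"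
    by auto
  then have "z = cmap (tangent_chart M c) (p, tvec_of M c p u)"
    using assms by (simp add: cmap_tangent_chart tvec_of_chart)
  moreover have "(p, tvec_of M c p u) \<in> cdom (tangent_chart M c) \<inter> cdom (tangent_chart M d)"
    using p assms tvec_of_in by (simp add: cdom_tangent_chart)
  ultimately show "z \<in> cmap (tangent_chart M c) ` (cdom (tangent_chart M c) \<inter> cdom (tangent_chart M d))"
    by (rule image_eqI)
qed (auto simp: cdom_tangent_chart cmap_tangent_chart)

lemma cotangent_chart_image:
  assumes "c \<in> M"
  shows "cmap (cotangent_chart M c) ` (cdom (cotangent_chart M c) \<inter> cdom (cotangent_chart M d)) =
    cmap c ` (cdom c \<inter> cdom d) \<times> UNIV"
proof (intro equalityI subsetI)
  fix z assume "z \<in> cmap c ` (cdom c \<inter> cdom d) \<times> (UNIV :: 'e set)"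
  then obtain p w where p: "p \<in> cdom c" "p \<in> cdom d" "z = (cmap c p, w)"
    by auto
  then have "z = cmap (cotangent_chart M c) (p, covec_of M c p w)"
    using assms by (simp add: cmap_cotangent_chart covec_comp_of)
  moreover have "(p, covec_of M c p w) \<in> cdom (cotangent_chart M c) \<inter> cdom (cotangent_chart M d)"
    using p covec_of_in by (simp add: cdom_cotangent_chart)
  ultimately show "z \<in> cmap (cotangent_chart M c) ` (cdom (cotangent_chart M c) \<inter> cdom (cotangent_chart M d))"
    by (rule image_eqI)
qed (auto simp: cdom_cotangent_chart cmap_cotangent_chart)

sublocale TM: coordinate_atlas "tangent M"
proof (intro coordinate_atlas.intro coordinate_atlas_axioms.intro)
  show "differentiable_atlas (tangent M)"
    unfolding tangent_def
  proof (rule differentiable_atlas_image)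
    fix c d assume cd: "c \<in> M" "d \<in> M"
    show "open (cmap (tangent_chart M c) ` (cdom (tangent_chart M c) \<inter> cdom (tangent_chart M d)))"
      using cd open_overlap by (simp add: tangent_chart_image open_Times)
    fix q assume q: "q \<in> cdom (tangent_chart M c)" "q \<in> cdom (tangent_chart M d)"
    let ?F = "\<lambda>z. ((cmap d \<circ> cinv c) (fst z),
      (\<lambda>(x, u). frechet_derivative (cmap d \<circ> cinv c) (at x) u) z)"
    show "cmap (tangent_chart M d) q = ?F (cmap (tangent_chart M c) q)"
      using cd q tangent_space_transition[of "snd q" "fst q" c d]
      by (auto simp: cdom_tangent_chart cmap_tangent_chart cinv_cmap)
    show "?F differentiable at (cmap (tangent_chart M c) q)"
      using cd q differentiable_transition_fst[of c d] differentiable_tangent_transition[of c d]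
      by (auto simp: cdom_tangent_chart cmap_tangent_chart intro!: differentiable_Pair)
  qed (rule inj_tangent_chart)
  show "finite_dimensional TYPE('e \<times> 'e)"
    using finite_dimensional_prod finite_dim by blast
qed

sublocale cotM: coordinate_atlas "cotangent M"
proof (intro coordinate_atlas.intro coordinate_atlas_axioms.intro)
  show "differentiable_atlas (cotangent M)"
    unfolding cotangent_def
  proof (rule differentiable_atlas_image)
    fix c d assume cd: "c \<in> M" "d \<in> M"
    show "open (cmap (cotangent_chart M c) ` (cdom (cotangent_chart M c) \<inter> cdom (cotangent_chart M d)))"
      using cd open_overlap by (simp add: cotangent_chart_image open_Times)
    fix q assume q: "q \<in> cdom (cotangent_chart M c)" "q \<in> cdom (cotangent_chart M d)"
    let ?F = "\<lambda>z. ((cmap d \<circ> cinv c) (fst z), covec_transition c d z)"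
    show "cmap (cotangent_chart M d) q = ?F (cmap (cotangent_chart M c) q)"
      using cd q covec_comp_transition[of c d "fst q" "snd q"]
      by (auto simp: cdom_cotangent_chart cmap_cotangent_chart cinv_cmap)
    show "?F differentiable at (cmap (cotangent_chart M c) q)"
      using cd q differentiable_transition_fst[of c d] differentiable_covec_transition[of c d]
      by (auto simp: cdom_cotangent_chart cmap_cotangent_chart intro!: differentiable_Pair)
  qed (rule inj_cotangent_chart)
  show "finite_dimensional TYPE('e \<times> 'e)"
    using finite_dimensional_prod finite_dim by blast
qed

lemma cdom_pairing_bundle_chart:
  "cdom (pairing_bundle_chart M c) =
    (\<lambda>(p, v, \<alpha>). ((p, v), (p, \<alpha>))) ` (SIGMA p:cdom c. tangent_space M p \<times> cotangent_space M p)"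
  by (auto simp: pairing_bundle_chart_def image_iff)

lemma cmap_pairing_bundle_chart:
  "cmap (pairing_bundle_chart M c) ((p, v), (q, \<alpha>)) = (cmap c p, v c, covec_comp M c q \<alpha>)"
  by (simp add: pairing_bundle_chart_def)

lemma inj_pairing_bundle_chart:
  assumes "c \<in> M"
  shows "inj_on (cmap (pairing_bundle_chart M c)) (cdom (pairing_bundle_chart M c))"
proof (rule inj_onI)
  fix y z
  assume "y \<in> cdom (pairing_bundle_chart M c)" "z \<in> cdom (pairing_bundle_chart M c)"
    and eq: "cmap (pairing_bundle_chart M c) y = cmap (pairing_bundle_chart M c) z"
  then obtain p v \<alpha> q w \<beta> where *: "y = ((p, v), (p, \<alpha>))" "z = ((q, w), (q, \<beta>))"
    "p \<in> cdom c" "v \<in> tangent_space M p" "\<alpha> \<in> cotangent_space M p"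
    "q \<in> cdom c" "w \<in> tangent_space M q" "\<beta> \<in> cotangent_space M q"
    by (auto simp: cdom_pairing_bundle_chart)
  with eq have **: "cmap c p = cmap c q" "v c = w c" "covec_comp M c p \<alpha> = covec_comp M c q \<beta>"
    by (auto simp: cmap_pairing_bundle_chart)
  then have "p = q"
    using * inj_chart[OF assms] by (auto dest: inj_onD)
  then show "y = z"
    using * ** covec_of_comp[OF assms] tvec_eqI[OF assms] by metis
qed

lemma pairing_bundle_chart_image:
  assumes "c \<in> M"
  shows "cmap (pairing_bundle_chart M c) ` (cdom (pairing_bundle_chart M c) \<inter> cdom (pairing_bundle_chart M d)) =
    cmap c ` (cdom c \<inter> cdom d) \<times> UNIV"
proof (intro equalityI subsetI)
  fix z assume "z \<in> cmap c ` (cdom c \<inter> cdom d) \<times> (UNIV :: ('e \<times> 'e) set)"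
  then obtain p u w where p: "p \<in> cdom c" "p \<in> cdom d" "z = (cmap c p, u, w)"
    by auto
  then have "z = cmap (pairing_bundle_chart M c) ((p, tvec_of M c p u), (p, covec_of M c p w))"
    using assms by (simp add: cmap_pairing_bundle_chart covec_comp_of tvec_of_chart)
  moreover have "((p, tvec_of M c p u), (p, covec_of M c p w)) \<in>
      cdom (pairing_bundle_chart M c) \<inter> cdom (pairing_bundle_chart M d)"
    using p assms tvec_of_in covec_of_in by (simp add: pairing_bundle_chart_def)
  ultimately show "z \<in> cmap (pairing_bundle_chart M c) `
      (cdom (pairing_bundle_chart M c) \<inter> cdom (pairing_bundle_chart M d))"
    by (rule image_eqI)
qed (auto simp: cdom_pairing_bundle_chart cmap_pairing_bundle_chart)

sublocale PB: differentiable_atlas "pairing_bundle M"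
  unfolding pairing_bundle_def
proof (rule differentiable_atlas_image)
  fix c d assume cd: "c \<in> M" "d \<in> M"
  let ?C = "pairing_bundle_chart M"
  show "open (cmap (?C c) ` (cdom (?C c) \<inter> cdom (?C d)))"
    using cd open_overlap by (simp add: pairing_bundle_chart_image open_Times)
  fix q assume q: "q \<in> cdom (?C c)" "q \<in> cdom (?C d)"
  let ?T = "\<lambda>(x, u). frechet_derivative (cmap d \<circ> cinv c) (at x) u"
  let ?F = "\<lambda>z. ((cmap d \<circ> cinv c) (fst z), ?T (fst z, fst (snd z)), covec_transition c d (fst z, snd (snd z)))"
  obtain p v \<alpha> where p: "q = ((p, v), (p, \<alpha>))" "p \<in> cdom c" "p \<in> cdom d"
    "v \<in> tangent_space M p" "\<alpha> \<in> cotangent_space M p"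
    using q by (auto simp: cdom_pairing_bundle_chart)
  show "cmap (?C d) q = ?F (cmap (?C c) q)"
    using cd p tangent_space_transition[of v p c d] covec_comp_transition[of c d p \<alpha>]
    by (simp add: cmap_pairing_bundle_chart cinv_cmap)
  have "(\<lambda>z::'e \<times> 'e \<times> 'e. (cmap d \<circ> cinv c) (fst z)) differentiable at (cmap (?C c) q)"
    unfolding p(1) cmap_pairing_bundle_chart
    by (rule differentiable_compose_fst[OF differentiable_transition[OF cd p(2,3)]])
  moreover have "(\<lambda>z::'e \<times> 'e \<times> 'e. ?T (fst z, fst (snd z))) differentiable at (cmap (?C c) q)"
  proof (rule differentiable_compose[where f = ?T and g = "\<lambda>z. (fst z, fst (snd z))"])
    show "?T differentiable at (fst (cmap (?C c) q), fst (snd (cmap (?C c) q)))"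
      using differentiable_tangent_transition[OF cd p(2,3)] p(1) by (simp add: cmap_pairing_bundle_chart)
  qed (intro bounded_linear_imp_differentiable bounded_linear_intros)
  moreover have "(\<lambda>z::'e \<times> 'e \<times> 'e. covec_transition c d (fst z, snd (snd z))) differentiable at (cmap (?C c) q)"
  proof (rule differentiable_compose[where f = "covec_transition c d" and g = "\<lambda>z. (fst z, snd (snd z))"])
    show "covec_transition c d differentiable at (fst (cmap (?C c) q), snd (snd (cmap (?C c) q)))"
      using differentiable_covec_transition[OF cd p(2,3)] p(1) by (simp add: cmap_pairing_bundle_chart)
  qed (intro bounded_linear_imp_differentiable bounded_linear_intros)
  ultimately show "?F differentiable at (cmap (?C c) q)"
    by (intro differentiable_Pair)
qed (rule inj_pairing_bundle_chart)

end

lemma differentiable_atlas_real_line: "differentiable_atlas real_line"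
proof
  fix c d :: "(real, real) chart" and p
  assume "c \<in> real_line" "d \<in> real_line"
  then have c: "c = Chart UNIV (\<lambda>t. t)" and d: "d = Chart UNIV (\<lambda>t. t)"
    by (auto simp: real_line_def)
  show "open (cmap c ` (cdom c \<inter> cdom d))" "inj_on (cmap c) (cdom c)"
    by (simp_all add: c d)
  have "inv_into UNIV (\<lambda>t::real. t) = (\<lambda>t. t)"
    by (rule inv_equality) auto
  then show "cmap d \<circ> cinv c differentiable at (cmap c p)"
    by (simp add: c d cinv_def o_def)
qed

section \<open>The canonical maps in coordinates\<close>

context manifold
begin

lemma tangent_chart_in: "c \<in> M \<Longrightarrow> tangent_chart M c \<in> tangent M"
  by (simp add: tangent_def)

lemma cotangent_chart_in: "c \<in> M \<Longrightarrow> cotangent_chart M c \<in> cotangent M"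
  by (simp add: cotangent_def)

lemma pairing_bundle_chart_in: "c \<in> M \<Longrightarrow> pairing_bundle_chart M c \<in> pairing_bundle M"
  by (simp add: pairing_bundle_def)

text \<open>The points of $TM$, $T^*M$, $TTM$ and $TT^*M$ over $p$ with given coordinates in the
  charts induced by $c$.\<close>

abbreviation tvec_pt where
  "tvec_pt c p u \<equiv> (p, tvec_of M c p u)"

abbreviation covec_pt where
  "covec_pt c p w \<equiv> (p, covec_of M c p w)"

abbreviation ttvec_pt where
  "ttvec_pt c p u a b \<equiv> (tvec_pt c p u, tvec_of (tangent M) (tangent_chart M c) (tvec_pt c p u) (a, b))"

abbreviation tcovec_pt where
  "tcovec_pt c p w a b \<equiv> (covec_pt c p w, tvec_of (cotangent M) (cotangent_chart M c) (covec_pt c p w) (a, b))"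

lemma tvec_pt_in: "c \<in> M \<Longrightarrow> p \<in> cdom c \<Longrightarrow> tvec_pt c p u \<in> cdom (tangent_chart M c)"
  by (simp add: cdom_tangent_chart tvec_of_in)

lemma covec_pt_in: "p \<in> cdom c \<Longrightarrow> covec_pt c p w \<in> cdom (cotangent_chart M c)"
  by (simp add: cdom_cotangent_chart covec_of_in)

lemmas ttvec_pt_in = TM.tvec_of_in[OF tangent_chart_in tvec_pt_in]
  and ttvec_pt_chart = TM.tvec_of_chart[OF tangent_chart_in tvec_pt_in]
  and tcovec_pt_in = cotM.tvec_of_in[OF cotangent_chart_in covec_pt_in]
  and tcovec_pt_chart = cotM.tvec_of_chart[OF cotangent_chart_in covec_pt_in]

lemma covec_pt_cases:
  assumes "c \<in> M" "p \<in> cdom c" "\<alpha> \<in> cotangent_space M p"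
  obtains w where "\<alpha> = covec_of M c p w"
  using covec_of_comp[OF assms] by metis

lemma tcovec_pt_cases:
  assumes "W \<in> points (tangent (cotangent M))"
  obtains p w a b where "p \<in> points M" "W = tcovec_pt (chart_at M p) p w a b"
proof -
  obtain p \<alpha> V where W: "W = ((p, \<alpha>), V)" "p \<in> points M" "\<alpha> \<in> cotangent_space M p"
    "V \<in> tangent_space (cotangent M) (p, \<alpha>)"
    using assms by (auto simp: cotM.points_tangent points_cotangent)
  let ?c = "chart_at M p"
  note c = chart_at[OF W(2)]
  obtain w where w: "\<alpha> = covec_of M ?c p w"
    using covec_pt_cases[OF c W(3)] by blast
  obtain a b where ab: "V (cotangent_chart M ?c) = (a, b)"
    by force
  have "V = tvec_of (cotangent M) (cotangent_chart M ?c) (covec_pt ?c p w) (a, b)"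
    using cotM.tvec_of_component[OF cotangent_chart_in[OF c(1)] covec_pt_in[OF c(2)], of V w] W(4) w ab
    by simp
  then show ?thesis
    using that W(1,2) w by blast
qed

text \<open>The canonical flip and the canonical bivector are defined with the chosen chart at the
  base point in $M$. Taking this chart as $c$ gives their coordinate expressions directly; both
  sides of the final equation lie over one point of $M$, so they can be compared in this chart.\<close>

lemma canonical_flip_coords:
  assumes p: "p \<in> points M" and c: "c = chart_at M p"
  shows "canonical_flip M (ttvec_pt c p u a b) = ttvec_pt c p a u b"
proof -
  have cp: "c \<in> M" "p \<in> cdom c"
    using chart_at[OF p] by (auto simp: c)
  have "cmap (tangent_chart (tangent M) (tangent_chart M c)) (ttvec_pt c p u a b) = ((cmap c p, u), (a, b))"
    by (simp add: TM.cmap_tangent_chart cmap_tangent_chart ttvec_pt_chart tvec_of_chart cp)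
  moreover have "cinv (tangent_chart (tangent M) (tangent_chart M c)) ((cmap c p, a), (u, b)) = ttvec_pt c p a u b"
    using TM.cinv_tangent_chart[OF tangent_chart_in tvec_pt_in, OF cp(1) cp, of a "(u, b)"]
    by (simp add: cmap_tangent_chart tvec_of_chart cp)
  ultimately show ?thesis
    by (simp add: canonical_flip_def Let_def c[symmetric])
qed

lemma tangent_map_projection:
  assumes c: "c \<in> M" "p \<in> cdom c"
  shows "tangent_map (cotangent M) M fst (tcovec_pt c p w a b) = tvec_pt c p a"
proof -
  have "tangent_map (cotangent M) M fst (tcovec_pt c p w a b) =
      (fst (covec_pt c p w), tvec_of M c (fst (covec_pt c p w))
        (fst (snd (tcovec_pt c p w a b) (cotangent_chart M c))))"
    unfolding snd_conv
  proof (rule tangent_map_in_charts[where g = fst])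
    show "(fst has_derivative fst) (at (cmap (cotangent_chart M c) (covec_pt c p w)))"
      by (auto intro: bounded_linear_imp_has_derivative bounded_linear_fst)
  qed (use c in \<open>auto simp: cotM.differentiable_atlas_axioms differentiable_atlas_axioms
      cotangent_chart_in covec_pt_in tcovec_pt_in cdom_cotangent_chart cmap_cotangent_chart covec_of_in\<close>)
  then show ?thesis
    by (simp add: tcovec_pt_chart c)
qed

lemma pairing_bundle_point_in:
  "p \<in> cdom c \<Longrightarrow> v \<in> tangent_space M p \<Longrightarrow> \<alpha> \<in> cotangent_space M p \<Longrightarrow>
    ((p, v), (p, \<alpha>)) \<in> cdom (pairing_bundle_chart M c)"
  by (simp add: pairing_bundle_chart_def)

context
  fixes c p v \<alpha> h
  assumes c: "c \<in> M" "p \<in> cdom c" and v: "v \<in> tangent_space M p" and \<alpha>: "\<alpha> \<in> cotangent_space M p"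
    and h: "h \<in> tangent_space (pairing_bundle M) ((p, v), (p, \<alpha>))"
begin

lemma tangent_map_pairing_bundle_fst:
  "tangent_map (pairing_bundle M) (tangent M) fst (((p, v), (p, \<alpha>)), h) =
    ((p, v), tvec_of (tangent M) (tangent_chart M c) (p, v)
      (fst (h (pairing_bundle_chart M c)), fst (snd (h (pairing_bundle_chart M c)))))"
proof -
  let ?q = "((p, v), (p, \<alpha>))"
  have "tangent_map (pairing_bundle M) (tangent M) fst (?q, h) =
      (fst ?q, tvec_of (tangent M) (tangent_chart M c) (fst ?q)
        ((\<lambda>z. (fst z, fst (snd z))) (h (pairing_bundle_chart M c))))"
  proof (rule tangent_map_in_charts[where g = "\<lambda>z. (fst z, fst (snd z))"])
    show "((\<lambda>z. (fst z, fst (snd z))) has_derivative (\<lambda>z. (fst z, fst (snd z))))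
        (at (cmap (pairing_bundle_chart M c) ?q))"
      by (intro derivative_eq_intros) auto
    show "fst q \<in> cdom (tangent_chart M c) \<and> cmap (tangent_chart M c) (fst q) =
        (fst (cmap (pairing_bundle_chart M c) q), fst (snd (cmap (pairing_bundle_chart M c) q)))"
      if "q \<in> cdom (pairing_bundle_chart M c)" for q
      using that
      by (auto simp: cdom_pairing_bundle_chart cmap_pairing_bundle_chart cdom_tangent_chart cmap_tangent_chart)
  qed (use c v \<alpha> h in \<open>auto simp: PB.differentiable_atlas_axioms TM.differentiable_atlas_axioms
      tangent_chart_in pairing_bundle_chart_in pairing_bundle_point_in\<close>)
  then show ?thesis
    by simp
qed

lemma tangent_map_pairing_bundle_snd:
  "tangent_map (pairing_bundle M) (cotangent M) snd (((p, v), (p, \<alpha>)), h) =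
    ((p, \<alpha>), tvec_of (cotangent M) (cotangent_chart M c) (p, \<alpha>)
      (fst (h (pairing_bundle_chart M c)), snd (snd (h (pairing_bundle_chart M c)))))"
proof -
  let ?q = "((p, v), (p, \<alpha>))"
  have "tangent_map (pairing_bundle M) (cotangent M) snd (?q, h) =
      (snd ?q, tvec_of (cotangent M) (cotangent_chart M c) (snd ?q)
        ((\<lambda>z. (fst z, snd (snd z))) (h (pairing_bundle_chart M c))))"
  proof (rule tangent_map_in_charts[where g = "\<lambda>z. (fst z, snd (snd z))"])
    show "((\<lambda>z. (fst z, snd (snd z))) has_derivative (\<lambda>z. (fst z, snd (snd z))))
        (at (cmap (pairing_bundle_chart M c) ?q))"
      by (intro derivative_eq_intros) auto
    show "snd q \<in> cdom (cotangent_chart M c) \<and> cmap (cotangent_chart M c) (snd q) =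
        (fst (cmap (pairing_bundle_chart M c) q), snd (snd (cmap (pairing_bundle_chart M c) q)))"
      if "q \<in> cdom (pairing_bundle_chart M c)" for q
      using that
      by (auto simp: cdom_pairing_bundle_chart cmap_pairing_bundle_chart cdom_cotangent_chart cmap_cotangent_chart)
  qed (use c v \<alpha> h in \<open>auto simp: PB.differentiable_atlas_axioms cotM.differentiable_atlas_axioms
      cotangent_chart_in pairing_bundle_chart_in pairing_bundle_point_in\<close>)
  then show ?thesis
    by simp
qed

lemma tangent_map_pairing:
  "snd (tangent_map (pairing_bundle M) real_line pairing (((p, v), (p, \<alpha>)), h)) (Chart UNIV (\<lambda>t. t)) =
    snd (snd (h (pairing_bundle_chart M c))) \<bullet> v c +
    covec_comp M c p \<alpha> \<bullet> fst (snd (h (pairing_bundle_chart M c)))"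
proof -
  let ?q = "((p, v), (p, \<alpha>))" and ?L = "Chart UNIV (\<lambda>t. t) :: (real, real) chart"
  let ?g' = "\<lambda>z. snd (snd z) \<bullet> v c + covec_comp M c p \<alpha> \<bullet> fst (snd z)"
  interpret L: differentiable_atlas real_line
    by (rule differentiable_atlas_real_line)
  have L: "?L \<in> real_line"
    by (simp add: real_line_def)
  have "tangent_map (pairing_bundle M) real_line pairing (?q, h) =
      (pairing ?q, tvec_of real_line ?L (pairing ?q) (?g' (h (pairing_bundle_chart M c))))"
  proof (rule tangent_map_in_charts[where g = "\<lambda>z. snd (snd z) \<bullet> fst (snd z)"])
    show "((\<lambda>z. snd (snd z) \<bullet> fst (snd z)) has_derivative ?g') (at (cmap (pairing_bundle_chart M c) ?q))"
      unfolding cmap_pairing_bundle_chart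
      by (auto intro!: derivative_eq_intros)
    show "pairing q \<in> cdom ?L \<and>
        cmap ?L (pairing q) = snd (snd (cmap (pairing_bundle_chart M c) q)) \<bullet> fst (snd (cmap (pairing_bundle_chart M c) q))"
      if "q \<in> cdom (pairing_bundle_chart M c)" for q
      using that c(1)
      by (auto simp: cdom_pairing_bundle_chart cmap_pairing_bundle_chart pairing_def covec_apply[of c])
  qed (use c v \<alpha> h L in \<open>auto simp: PB.differentiable_atlas_axioms L.differentiable_atlas_axioms
      pairing_bundle_chart_in pairing_bundle_point_in\<close>)
  then show ?thesis
    using L.tvec_of_chart[OF L] by simp
qed

end

text \<open>Differentiating the pairing $\<langle>u, w\<rangle>$ gives $b \<cdot> u + w \<cdot> a$ by the product rule; the
  tangent vector of $TM \<times>_M T^*M$ in the definition has the coordinates of the two given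
  vectors.\<close>

lemma tangent_pairing_coords:
  assumes c: "c \<in> M" "p \<in> cdom c"
  shows "tangent_pairing M (ttvec_pt c p u x a) (tcovec_pt c p w x b) = b \<bullet> u + w \<bullet> a"
proof -
  let ?P = "pairing_bundle_chart M c"
  let ?q = "(tvec_pt c p u, covec_pt c p w)"
  let ?h = "tvec_of (pairing_bundle M) ?P ?q (x, a, b)"
  note q = pairing_bundle_point_in[OF c(2) tvec_of_in[OF c] covec_of_in]
  have h: "?h \<in> tangent_space (pairing_bundle M) ?q"
    by (rule PB.tvec_of_in[OF pairing_bundle_chart_in[OF c(1)] q])
  have hc: "?h ?P = (x, a, b)"
    by (rule PB.tvec_of_chart[OF pairing_bundle_chart_in[OF c(1)] q])
  have "(THE y. y \<in> points (tangent (pairing_bundle M)) \<and>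
      tangent_map (pairing_bundle M) (tangent M) fst y = ttvec_pt c p u x a \<and>
      tangent_map (pairing_bundle M) (cotangent M) snd y = tcovec_pt c p w x b) = (?q, ?h)"
  proof (rule the_equality, intro conjI)
    have "?q \<in> points (pairing_bundle M)"
      using q pairing_bundle_chart_in[OF c(1)] unfolding points_def by blast
    then show "(?q, ?h) \<in> points (tangent (pairing_bundle M))"
      using h by (simp add: PB.points_tangent)
    show "tangent_map (pairing_bundle M) (tangent M) fst (?q, ?h) = ttvec_pt c p u x a"
      using tangent_map_pairing_bundle_fst[OF c tvec_of_in[OF c] covec_of_in h] hc by simp
    show "tangent_map (pairing_bundle M) (cotangent M) snd (?q, ?h) = tcovec_pt c p w x b"
      using tangent_map_pairing_bundle_snd[OF c tvec_of_in[OF c] covec_of_in h] hc by simp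
  next
    fix y
    assume y: "y \<in> points (tangent (pairing_bundle M)) \<and>
      tangent_map (pairing_bundle M) (tangent M) fst y = ttvec_pt c p u x a \<and>
      tangent_map (pairing_bundle M) (cotangent M) snd y = tcovec_pt c p w x b"
    then have "fst (fst y) = tvec_pt c p u" "snd (fst y) = covec_pt c p w"
      by (auto simp: tangent_map_def split_def)
    then obtain k where k: "y = (?q, k)"
      by (metis prod.collapse)
    with y have kt: "k \<in> tangent_space (pairing_bundle M) ?q"
      by (simp add: PB.points_tangent)
    have "tvec_of (tangent M) (tangent_chart M c) (tvec_pt c p u) (fst (k ?P), fst (snd (k ?P))) =
        tvec_of (tangent M) (tangent_chart M c) (tvec_pt c p u) (x, a)"
      using tangent_map_pairing_bundle_fst[OF c tvec_of_in[OF c] covec_of_in kt] y k by simp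
    then have 1: "(fst (k ?P), fst (snd (k ?P))) = (x, a)"
      using ttvec_pt_chart[OF c(1) c] by metis
    have "tvec_of (cotangent M) (cotangent_chart M c) (covec_pt c p w) (fst (k ?P), snd (snd (k ?P))) =
        tvec_of (cotangent M) (cotangent_chart M c) (covec_pt c p w) (x, b)"
      using tangent_map_pairing_bundle_snd[OF c tvec_of_in[OF c] covec_of_in kt] y k by simp
    then have 2: "(fst (k ?P), snd (snd (k ?P))) = (x, b)"
      using tcovec_pt_chart[OF c(1) c(2)] by metis
    have "k ?P = ?h ?P"
      using 1 2 unfolding hc by (simp add: prod_eq_iff)
    then have "k = ?h"
      by (rule PB.tvec_eqI[OF pairing_bundle_chart_in[OF c(1)] q kt h])
    then show "y = (?q, ?h)"
      using k by simp
  qed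
  then show ?thesis
    using tangent_map_pairing[OF c tvec_of_in[OF c] covec_of_in h] hc
    by (simp add: tangent_pairing_def tvec_of_chart covec_comp_of c)
qed

text \<open>By the flip, the vector of $TTM$ paired with \<open>tcovec_pt c p w u b\<close> has base velocity \<open>u\<close>
  and fibre component \<open>x\<close>, where $(x, a)$ is the vector to which the covector is applied; the
  pairing $b \<cdot> x + w \<cdot> a$ then has the components $(b, w)$.\<close>

lemma alpha_map_coords:
  assumes p: "p \<in> points M" and c: "c = chart_at M p"
  shows "alpha_map M (tcovec_pt c p w u b) =
    (tvec_pt c p u, covec_of (tangent M) (tangent_chart M c) (tvec_pt c p u) (b, w))"
proof -
  have cp: "c \<in> M" "p \<in> cdom c"
    using chart_at[OF p] by (auto simp: c)
  have "tangent_pairing M (canonical_flip M (tvec_pt c p u, V)) (tcovec_pt c p w u b) =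
      (b, w) \<bullet> V (tangent_chart M c)"
    if V: "V \<in> tangent_space (tangent M) (tvec_pt c p u)" for V
  proof -
    obtain x a where xa: "V (tangent_chart M c) = (x, a)"
      by force
    then have "(tvec_pt c p u, V) = ttvec_pt c p u x a"
      using TM.tvec_of_component[OF tangent_chart_in tvec_pt_in V, OF cp(1) cp] by simp
    then show ?thesis
      using canonical_flip_coords[OF p c] tangent_pairing_coords[OF cp] xa by simp
  qed
  then show ?thesis
    unfolding alpha_map_def Let_def tangent_map_projection[OF cp] covec_of_def[of "tangent M"]
    by (simp cong: if_cong)
qed

text \<open>The inverse of \<open>\<alpha>\<^sub>M\<close> is a Hilbert choice of preimage; it is the expected one because the
  coordinates of the image determine the base point, $u$, $b$ and $w$.\<close>

lemma epsilon_map_coords: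
  assumes p: "p \<in> points M" and c: "c = chart_at M p"
  shows "epsilon_map M (tvec_pt c p u, covec_of (tangent M) (tangent_chart M c) (tvec_pt c p u) (b, w)) =
    tcovec_pt c p w u b"
proof -
  have cp: "c \<in> M" "p \<in> cdom c"
    using chart_at[OF p] by (auto simp: c)
  have "inj_on (alpha_map M) (points (tangent (cotangent M)))"
  proof (rule inj_onI)
    fix W W' assume W: "W \<in> points (tangent (cotangent M))" "W' \<in> points (tangent (cotangent M))"
      and eq: "alpha_map M W = alpha_map M W'"
    obtain q w a b where q: "q \<in> points M" "W = tcovec_pt (chart_at M q) q w a b"
      using tcovec_pt_cases[OF W(1)] by blast
    obtain q' w' a' b' where q': "q' \<in> points M" "W' = tcovec_pt (chart_at M q') q' w' a' b'"
      using tcovec_pt_cases[OF W(2)] by blast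
    let ?d = "chart_at M q"
    note d = chart_at[OF q(1)]
    have "q' = q"
      using eq unfolding q(2) q'(2) alpha_map_coords[OF q(1) refl] alpha_map_coords[OF q'(1) refl] by simp
    moreover from this have ta: "tvec_of M ?d q a = tvec_of M ?d q a'"
      using eq unfolding q(2) q'(2) alpha_map_coords[OF q(1) refl] alpha_map_coords[OF q'(1) refl] by simp
    then have "a = a'"
      using tvec_of_chart[OF d] by metis
    moreover have "covec_of (tangent M) (tangent_chart M ?d) (tvec_pt ?d q a) (b, w) =
        covec_of (tangent M) (tangent_chart M ?d) (tvec_pt ?d q a) (b', w')"
      using eq \<open>q' = q\<close> \<open>a = a'\<close> unfolding q(2) q'(2) alpha_map_coords[OF q(1) refl] alpha_map_coords[OF q'(1) refl]
      by simp
    then have "(b, w) = (b', w')"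
      using TM.covec_comp_of[OF tangent_chart_in[OF d(1)] tvec_pt_in[OF d]] by metis
    ultimately show "W = W'"
      using q(2) q'(2) by simp
  qed
  moreover have "tcovec_pt c p w u b \<in> points (tangent (cotangent M))"
    using p tcovec_pt_in[OF cp(1) cp(2)] covec_of_in by (simp add: cotM.points_tangent points_cotangent)
  ultimately show ?thesis
    unfolding epsilon_map_def alpha_map_coords[OF p c, symmetric] by (rule inv_into_f_f)
qed

lemma canonical_bivector_coords:
  assumes p: "p \<in> points M" and c: "c = chart_at M p"
  defines "C \<equiv> cotangent_chart M c"
  shows "canonical_bivector M (covec_pt c p w) (covec_of (cotangent M) C (covec_pt c p w) (a, b))
      (covec_of (cotangent M) C (covec_pt c p w) (a', b')) = a \<bullet> b' - b \<bullet> a'"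
proof -
  have cp: "c \<in> M" "p \<in> cdom c"
    using chart_at[OF p] by (auto simp: c)
  have "canonical_bivector M (covec_pt c p w) (covec_of (cotangent M) C (covec_pt c p w) (a, b))
      (covec_of (cotangent M) C (covec_pt c p w) (a', b')) =
    (\<Sum>i\<in>coord_basis. (a \<bullet> i) * (b' \<bullet> i) - (b \<bullet> i) * (a' \<bullet> i))"
    by (simp add: canonical_bivector_def wedge_def c[symmetric] C_def cotM.covec_of_apply tcovec_pt_in[OF cp(1) cp(2)]
        tcovec_pt_chart[OF cp(1) cp(2)])
  then show ?thesis
    by (simp add: sum_subtractf coord_parseval[OF finite_dim])
qed

text \<open>The sign comes from contracting in the first argument: $\<Lambda>_M$ of $(a, b)$ and $(a', b')$ is
  $a \<cdot> b' - b \<cdot> a'$, the pairing of $(a', b')$ with $(-b, a)$.\<close>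

lemma canonical_sharp_coords:
  assumes p: "p \<in> points M" and c: "c = chart_at M p"
  shows "sharp (cotangent M) (canonical_bivector M)
      (covec_pt c p w, covec_of (cotangent M) (cotangent_chart M c) (covec_pt c p w) (a, b)) = tcovec_pt c p w (- b) a"
proof (rule cotM.sharp_eqI)
  have cp: "c \<in> M" "p \<in> cdom c"
    using chart_at[OF p] by (auto simp: c)
  show "covec_pt c p w \<in> points (cotangent M)"
    using p covec_of_in by (simp add: points_cotangent)
  show V: "tvec_of (cotangent M) (cotangent_chart M c) (covec_pt c p w) (- b, a) \<in>
      tangent_space (cotangent M) (covec_pt c p w)"
    by (rule tcovec_pt_in[OF cp(1) cp(2)])
  fix \<beta> assume \<beta>: "\<beta> \<in> cotangent_space (cotangent M) (covec_pt c p w)"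
  obtain a' b' where ab: "\<beta> = covec_of (cotangent M) (cotangent_chart M c) (covec_pt c p w) (a', b')"
    using cotM.covec_of_comp[OF cotangent_chart_in[OF cp(1)] covec_pt_in[OF cp(2)] \<beta>] by (metis prod.exhaust)
  show "\<beta> (tvec_of (cotangent M) (cotangent_chart M c) (covec_pt c p w) (- b, a)) =
      canonical_bivector M (covec_pt c p w) (covec_of (cotangent M) (cotangent_chart M c) (covec_pt c p w) (a, b)) \<beta>"
    unfolding ab canonical_bivector_coords[OF p c] cotM.covec_of_apply[OF V] tcovec_pt_chart[OF cp(1) cp(2)]
    by (simp add: inner_commute)
qed

end

section \<open>Morphisms in coordinates\<close>

lemma Ck_on_cong:
  assumes "open S" "\<And>x. x \<in> S \<Longrightarrow> f x = g x" "Ck_on k S f"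
  shows "Ck_on k S g"
  using assms(2,3)
proof (induction k arbitrary: f g)
  case 0
  then show ?case
    using continuous_on_cong by fastforce
next
  case (Suc k)
  have g: "(g has_derivative frechet_derivative f (at x)) (at x)" if "x \<in> S" for x
    using has_derivative_transform_within_open[OF _ assms(1) that Suc.prems(1)] Suc.prems(2) that
    by (auto simp: frechet_derivative_works)
  show ?case
    unfolding Ck_on.simps
  proof (intro conjI ballI allI)
    show "g differentiable (at x)" if "x \<in> S" for x
      using g[OF that] by (auto simp: differentiable_def)
    show "Ck_on k S (\<lambda>x. frechet_derivative g (at x) v)" for v
    proof (rule Suc.IH)
      show "frechet_derivative f (at x) v = frechet_derivative g (at x) v" if "x \<in> S" for x
        using frechet_derivative_at[OF g[OF that]] by simp
      show "Ck_on k S (\<lambda>x. frechet_derivative f (at x) v)"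
        using Suc.prems(2) by simp
    qed
  qed
qed

lemma smooth_on_cong:
  "open S \<Longrightarrow> (\<And>x. x \<in> S \<Longrightarrow> f x = g x) \<Longrightarrow> smooth_on S f \<Longrightarrow> smooth_on S g"
  unfolding smooth_on_def using Ck_on_cong by blast

text \<open>This transfers smoothness of $\<lambda>$ on $T^*M$ to the coefficients of the bivector field on
  $M$, which are components of $\<lambda>$ along the slices with $w$ constant.\<close>

lemma Ck_on_slice:
  assumes S: "open S" and h: "bounded_linear h" and f: "Ck_on k (S \<times> UNIV) f"
  shows "Ck_on k S (\<lambda>x. h (f (x, w)))"
  using f
proof (induction k arbitrary: f)
  case 0
  have "continuous_on S (\<lambda>x. f (x, w))"
    using 0 by (auto intro!: continuous_on_compose2[of "S \<times> UNIV" f] continuous_intros)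
  then show ?case
    by (simp add: bounded_linear.continuous_on[OF h])
next
  case (Suc k)
  have d: "((\<lambda>x. h (f (x, w))) has_derivative (\<lambda>v. h (frechet_derivative f (at (x, w)) (v, 0)))) (at x)"
    if x: "x \<in> S" for x
  proof -
    have "(f has_derivative frechet_derivative f (at (x, w))) (at (x, w))"
      using Suc.prems x by (simp add: frechet_derivative_works[symmetric])
    moreover have "((\<lambda>x. (x, w)) has_derivative (\<lambda>v. (v, 0))) (at x)"
      by (auto intro!: derivative_eq_intros)
    ultimately have "((\<lambda>x. f (x, w)) has_derivative (\<lambda>v. frechet_derivative f (at (x, w)) (v, 0))) (at x)"
      using has_derivative_compose[of "\<lambda>x. (x, w)"] by blast
    then show ?thesis
      by (rule bounded_linear.has_derivative[OF h])
  qed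
  show ?case
    unfolding Ck_on.simps
  proof (intro conjI ballI allI)
    show "(\<lambda>x. h (f (x, w))) differentiable (at x)" if "x \<in> S" for x
      using d[OF that] by (auto simp: differentiable_def)
    show "Ck_on k S (\<lambda>x. frechet_derivative (\<lambda>x. h (f (x, w))) (at x) v)" for v
    proof (rule Ck_on_cong[OF S])
      show "h (frechet_derivative f (at (x, w)) (v, 0)) = frechet_derivative (\<lambda>x. h (f (x, w))) (at x) v"
        if "x \<in> S" for x
        using frechet_derivative_at[OF d[OF that]] by metis
      show "Ck_on k S (\<lambda>x. h (frechet_derivative f (at (x, w)) (v, 0)))"
        using Suc.prems by (intro Suc.IH) simp
    qed
  qed
qed

lemma smooth_on_slice:
  "open S \<Longrightarrow> bounded_linear h \<Longrightarrow> smooth_on (S \<times> UNIV) f \<Longrightarrow> smooth_on S (\<lambda>x. h (f (x, w)))"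
  unfolding smooth_on_def using Ck_on_slice by blast

locale cotangent_tangent_morphism = manifold M
  for M :: "('a, 'e::real_inner) atlas" +
  fixes lam :: "'a \<times> ('a, 'e) covec \<Rightarrow> 'a \<times> ('a, 'e) tvec"
  assumes morphism: "bundle_morphism M lam"
begin

lemma lam_in:
  assumes "p \<in> points M" "\<alpha> \<in> cotangent_space M p"
  shows "lam (p, \<alpha>) = (p, snd (lam (p, \<alpha>)))" "snd (lam (p, \<alpha>)) \<in> tangent_space M p"
proof -
  have "fst (lam (p, \<alpha>)) = p" "lam (p, \<alpha>) \<in> points (tangent M)"
    using morphism assms unfolding bundle_morphism_def smooth_map_def points_cotangent by blast+
  then show "lam (p, \<alpha>) = (p, snd (lam (p, \<alpha>)))" "snd (lam (p, \<alpha>)) \<in> tangent_space M p"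
    by (auto simp: points_tangent prod_eq_iff)
qed

text \<open>In the charts induced by $c$, the morphism is \<open>(x, w) \<mapsto> (x, rep c x w)\<close>; \<open>drep c x w u\<close> is
  the derivative of this matrix-valued function in the direction $u$, applied to $w$.\<close>

definition rep :: "('a, 'e) chart \<Rightarrow> 'e \<Rightarrow> 'e \<Rightarrow> 'e" where
  "rep c x w = snd (lam (covec_pt c (cinv c x) w)) c"

definition drep :: "('a, 'e) chart \<Rightarrow> 'e \<Rightarrow> 'e \<Rightarrow> 'e \<Rightarrow> 'e" where
  "drep c x w u = frechet_derivative (\<lambda>x. rep c x w) (at x) u"

lemma chart_point: "c \<in> M \<Longrightarrow> p \<in> cdom c \<Longrightarrow> p \<in> points M"
  by (auto simp: points_def)

lemma lam_coords:
  assumes c: "c \<in> M" "p \<in> cdom c"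
  shows "lam (covec_pt c p w) = tvec_pt c p (rep c (cmap c p) w)"
  using lam_in[OF chart_point[OF c] covec_of_in] tvec_of_component[OF c]
  by (simp add: rep_def cinv_cmap c)

lemma lam_comb:
  assumes "p \<in> points M" "\<alpha> \<in> cotangent_space M p" "\<beta> \<in> cotangent_space M p"
  shows "snd (lam (p, \<lambda>v. r * \<alpha> v + s * \<beta> v)) =
    (\<lambda>c. r *\<^sub>R snd (lam (p, \<alpha>)) c + s *\<^sub>R snd (lam (p, \<beta>)) c)"
  using morphism assms unfolding bundle_morphism_def by blast

lemma rep_comb:
  assumes c: "c \<in> M" "p \<in> cdom c"
  shows "rep c (cmap c p) (r *\<^sub>R v + s *\<^sub>R w) = r *\<^sub>R rep c (cmap c p) v + s *\<^sub>R rep c (cmap c p) w"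
  unfolding rep_def covec_of_comb cinv_cmap[OF c] lam_comb[OF chart_point[OF c] covec_of_in covec_of_in] ..

lemma linear_rep:
  assumes c: "c \<in> M" "p \<in> cdom c"
  shows "linear (rep c (cmap c p))"
proof (rule linearI)
  show "rep c (cmap c p) (v + w) = rep c (cmap c p) v + rep c (cmap c p) w" for v w
    using rep_comb[OF c, of 1 v 1 w] by simp
  show "rep c (cmap c p) (r *\<^sub>R v) = r *\<^sub>R rep c (cmap c p) v" for r v
    using rep_comb[OF c, of r v 0 v] by simp
qed

lemma lam_in_chart:
  assumes c: "c \<in> M" and q: "q \<in> cdom (cotangent_chart M c)"
  shows "lam q \<in> cdom (tangent_chart M c)"
proof -
  obtain p \<alpha> where p: "q = (p, \<alpha>)" "p \<in> cdom c" "\<alpha> \<in> cotangent_space M p"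
    using q by (auto simp: cdom_cotangent_chart)
  show ?thesis
    unfolding p(1) cdom_tangent_chart using lam_in[OF chart_point[OF c p(2)] p(3)] p(2)
    by (metis SigmaI)
qed

lemma smooth_rep_pair:
  assumes c: "c \<in> M"
  shows "smooth_on (cmap c ` cdom c \<times> UNIV) (\<lambda>(x, w). (x, rep c x w))"
proof -
  let ?C = "cotangent_chart M c" and ?T = "tangent_chart M c"
  have sub: "cdom ?C \<inter> lam -` cdom ?T = cdom ?C"
    using lam_in_chart[OF c] by blast
  have im: "cmap ?C ` cdom ?C = cmap c ` cdom c \<times> UNIV"
    using cotangent_chart_image[OF c, of c] by simp
  have "smooth_on (cmap ?C ` (cdom ?C \<inter> lam -` cdom ?T)) (cmap ?T \<circ> lam \<circ> cinv ?C)"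
    using morphism cotangent_chart_in[OF c] tangent_chart_in[OF c]
    unfolding bundle_morphism_def smooth_map_def by blast
  then have sm: "smooth_on (cmap c ` cdom c \<times> UNIV) (cmap ?T \<circ> lam \<circ> cinv ?C)"
    unfolding sub im .
  show ?thesis
  proof (rule smooth_on_cong[OF _ _ sm])
    show "open (cmap c ` cdom c \<times> (UNIV :: 'e set))"
      using open_chart[OF c] by (simp add: open_Times)
    fix z assume "z \<in> cmap c ` cdom c \<times> (UNIV :: 'e set)"
    then obtain p w where p: "p \<in> cdom c" "z = (cmap c p, w)"
      by auto
    then show "(cmap ?T \<circ> lam \<circ> cinv ?C) z = (\<lambda>(x, w). (x, rep c x w)) z"
      by (simp add: cinv_cotangent_chart[OF c] lam_coords[OF c] cmap_tangent_chart tvec_of_chart[OF c])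
  qed
qed

lemma smooth_rep_component:
  assumes c: "c \<in> M"
  shows "smooth_on (cmap c ` cdom c) (\<lambda>x. v \<bullet> rep c x w)"
proof -
  have "bounded_linear (\<lambda>z::'e \<times> 'e. v \<bullet> snd z)"
    by (intro bounded_linear_intros)
  from smooth_on_slice[OF open_chart[OF c] this smooth_rep_pair[OF c], of w] show ?thesis
    by simp
qed

lemma rep_has_derivative:
  assumes c: "c \<in> M" "p \<in> cdom c"
  shows "((\<lambda>x. rep c x w) has_derivative drep c (cmap c p) w) (at (cmap c p))"
proof -
  have "smooth_on (cmap c ` cdom c) (\<lambda>x. rep c x w)"
    using smooth_on_slice[OF open_chart[OF c(1)] bounded_linear_snd smooth_rep_pair[OF c(1)], of w] by simp
  then have "(\<lambda>x. rep c x w) differentiable (at (cmap c p))"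
    by (rule smooth_on_differentiable) (use c in auto)
  then show ?thesis
    unfolding drep_def by (simp add: frechet_derivative_works[symmetric] eta_contract_eq)
qed

lemma linear_drep:
  "c \<in> M \<Longrightarrow> p \<in> cdom c \<Longrightarrow> linear (drep c (cmap c p) w)"
  using rep_has_derivative has_derivative_linear by blast

text \<open>The derivative is the sum of the partial derivatives: the one along $M$ is that of a
  slice, and the one along the fibre is the map itself, since $\<lambda>$ is linear in the fibre.\<close>

lemma rep_pair_has_derivative:
  assumes c: "c \<in> M" "p \<in> cdom c"
  shows "((\<lambda>(x, w). (x, rep c x w)) has_derivative
      (\<lambda>(u, z). (u, drep c (cmap c p) w u + rep c (cmap c p) z))) (at (cmap c p, w))"
proof -
  let ?x = "cmap c p"
  let ?f = "\<lambda>(x, w). rep c x w"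
  have "(\<lambda>(x, w). (x, rep c x w)) differentiable (at (?x, w))"
    by (rule smooth_on_differentiable[OF smooth_rep_pair[OF c(1)]]) (use c in auto)
  then obtain G where G: "((\<lambda>(x, w). (x, rep c x w)) has_derivative G) (at (?x, w))"
    by (auto simp: differentiable_def)
  define F where "F z = snd (G z)" for z
  have F: "(?f has_derivative F) (at (?x, w))"
    using has_derivative_snd[OF G] by (simp add: F_def[abs_def] split_def)
  have "((\<lambda>x. (x, w)) has_derivative (\<lambda>u. (u, 0))) (at ?x)"
    by (auto intro!: derivative_eq_intros)
  then have "((\<lambda>x. ?f (x, w)) has_derivative (\<lambda>u. F (u, 0))) (at ?x)"
    using has_derivative_compose[of "\<lambda>x. (x, w)"] F by blast
  then have 1: "F (u, 0) = drep c ?x w u" for u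
    using has_derivative_unique[OF rep_has_derivative[OF c, of w]] by (simp add: fun_eq_iff)
  have inner: "((\<lambda>z. (?x, z)) has_derivative (\<lambda>z. (0, z))) (at w)"
    by (auto intro!: derivative_eq_intros)
  then have fib: "((\<lambda>z. ?f (?x, z)) has_derivative (\<lambda>z. F (0, z))) (at w)"
    using has_derivative_compose[of "\<lambda>z. (?x, z)"] F by blast
  have 2: "F (0, z) = rep c ?x z" for z
  proof -
    \<comment> \<open>Restricted to a line in the fibre, the map is affine, with slope its value at \<open>z\<close>.\<close>
    have line: "((\<lambda>t. w + t *\<^sub>R z) has_derivative (\<lambda>t. t *\<^sub>R z)) (at (0::real))"
      by (auto intro!: derivative_eq_intros)
    have "((\<lambda>t. rep c ?x (w + t *\<^sub>R z)) has_derivative (\<lambda>t. F (0, t *\<^sub>R z))) (at 0)"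
      using has_derivative_compose[OF line, of "rep c ?x"] fib by simp
    then have "((\<lambda>t. rep c ?x w + t *\<^sub>R rep c ?x z) has_derivative (\<lambda>t. F (0, t *\<^sub>R z))) (at 0)"
      by (simp add: linear_add[OF linear_rep[OF c]] linear_scale[OF linear_rep[OF c]])
    moreover have "((\<lambda>t. rep c ?x w + t *\<^sub>R rep c ?x z) has_derivative (\<lambda>t. t *\<^sub>R rep c ?x z)) (at (0::real))"
      by (auto intro!: derivative_eq_intros)
    ultimately have "(\<lambda>t. F (0, t *\<^sub>R z)) = (\<lambda>t::real. t *\<^sub>R rep c ?x z)"
      by (rule has_derivative_unique)
    from fun_cong[OF this, of 1] show ?thesis
      by simp
  qed
  have "F (u, z) = drep c ?x w u + rep c ?x z" for u z
    using linear_add[OF has_derivative_linear[OF F], of "(u, 0)" "(0, z)"] 1 2 by simp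
  then have "F = (\<lambda>(u, z). drep c ?x w u + rep c ?x z)"
    by auto
  with F have "(?f has_derivative (\<lambda>(u, z). drep c ?x w u + rep c ?x z)) (at (?x, w))"
    by simp
  then have "((\<lambda>z. (fst z, ?f z)) has_derivative (\<lambda>z. (fst z, (\<lambda>(u, z). drep c ?x w u + rep c ?x z) z))) (at (?x, w))"
    by (intro has_derivative_Pair has_derivative_fst has_derivative_ident)
  then show ?thesis
    by (simp add: split_def)
qed

lemma tangent_map_lam_apply:
  assumes c: "c \<in> M" "p \<in> cdom c"
    and V: "V \<in> tangent_space (cotangent M) (covec_pt c p w)"
  shows "tangent_map (cotangent M) (tangent M) lam (covec_pt c p w, V) =
    ttvec_pt c p (rep c (cmap c p) w) (fst (V (cotangent_chart M c)))
      (drep c (cmap c p) w (fst (V (cotangent_chart M c))) + rep c (cmap c p) (snd (V (cotangent_chart M c))))"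
proof -
  let ?C = "cotangent_chart M c" and ?T = "tangent_chart M c"
  have "tangent_map (cotangent M) (tangent M) lam (covec_pt c p w, V) =
      (lam (covec_pt c p w), tvec_of (tangent M) ?T (lam (covec_pt c p w))
        ((\<lambda>(u, z). (u, drep c (cmap c p) w u + rep c (cmap c p) z)) (V ?C)))"
  proof (rule tangent_map_in_charts)
    show "((\<lambda>(x, w). (x, rep c x w)) has_derivative
        (\<lambda>(u, z). (u, drep c (cmap c p) w u + rep c (cmap c p) z))) (at (cmap ?C (covec_pt c p w)))"
      using rep_pair_has_derivative[OF c] by (simp add: cmap_cotangent_chart covec_comp_of c)
    show "lam q \<in> cdom ?T \<and> cmap ?T (lam q) = (\<lambda>(x, w). (x, rep c x w)) (cmap ?C q)" if q: "q \<in> cdom ?C" for q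
    proof -
      obtain s \<alpha> where s: "q = (s, \<alpha>)" "s \<in> cdom c" "\<alpha> \<in> cotangent_space M s"
        using q by (auto simp: cdom_cotangent_chart)
      obtain z where "\<alpha> = covec_of M c s z"
        using covec_pt_cases[OF c(1) s(2,3)] by blast
      then show ?thesis
        using s(1,2) c(1)
        by (simp add: lam_coords tvec_pt_in cmap_tangent_chart cmap_cotangent_chart covec_comp_of tvec_of_chart)
    qed
  qed (use c V in \<open>auto simp: cotM.differentiable_atlas_axioms TM.differentiable_atlas_axioms
      cotangent_chart_in tangent_chart_in covec_pt_in\<close>)
  then show ?thesis
    by (simp add: lam_coords[OF c] split_def)
qed

lemma tangent_map_lam:
  assumes c: "c \<in> M" "p \<in> cdom c"
  shows "tangent_map (cotangent M) (tangent M) lam (tcovec_pt c p w u z) =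
    ttvec_pt c p (rep c (cmap c p) w) u (drep c (cmap c p) w u + rep c (cmap c p) z)"
  using tangent_map_lam_apply[OF c tcovec_pt_in[OF c]] by (simp add: tcovec_pt_chart[OF c])

text \<open>Transposes with respect to the inner product of coordinates; they give the components of a
  pulled back covector.\<close>

definition rep_adj :: "('a, 'e) chart \<Rightarrow> 'e \<Rightarrow> 'e \<Rightarrow> 'e" where
  "rep_adj c x b = (\<Sum>i\<in>coord_basis. (b \<bullet> rep c x i) *\<^sub>R i)"

definition drep_adj :: "('a, 'e) chart \<Rightarrow> 'e \<Rightarrow> 'e \<Rightarrow> 'e \<Rightarrow> 'e" where
  "drep_adj c x w b = (\<Sum>i\<in>coord_basis. (b \<bullet> drep c x w i) *\<^sub>R i)"

lemma inner_linear: "linear f \<Longrightarrow> linear (\<lambda>u. b \<bullet> f u)"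
  for f :: "'e \<Rightarrow> 'e"
  by (auto intro!: linearI simp: linear_add linear_scale inner_add_right)

lemma rep_adj:
  "c \<in> M \<Longrightarrow> p \<in> cdom c \<Longrightarrow> rep_adj c (cmap c p) b \<bullet> z = b \<bullet> rep c (cmap c p) z"
  unfolding rep_adj_def by (rule linear_form_eq_inner[OF finite_dim inner_linear[OF linear_rep], symmetric])

lemma drep_adj:
  "c \<in> M \<Longrightarrow> p \<in> cdom c \<Longrightarrow> drep_adj c (cmap c p) w b \<bullet> u = b \<bullet> drep c (cmap c p) w u"
  unfolding drep_adj_def by (rule linear_form_eq_inner[OF finite_dim inner_linear[OF linear_drep], symmetric])

lemma pullback_covec_coords:
  assumes c: "c \<in> M" "p \<in> cdom c"
  shows "pullback_covec (cotangent M) (tangent M) lam (covec_pt c p w)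
      (covec_of (tangent M) (tangent_chart M c) (lam (covec_pt c p w)) (a, b)) =
    covec_of (cotangent M) (cotangent_chart M c) (covec_pt c p w)
      (a + drep_adj c (cmap c p) w b, rep_adj c (cmap c p) b)" (is "?l = ?r")
proof
  fix V
  show "?l V = ?r V"
  proof (cases "V \<in> tangent_space (cotangent M) (covec_pt c p w)")
    case True
    show ?thesis
      using True
      by (cases "V (cotangent_chart M c)")
        (simp add: pullback_covec_def tangent_map_lam_apply[OF c True] cotM.covec_of_apply
          lam_coords[OF c] TM.covec_of_apply ttvec_pt_in ttvec_pt_chart c
          rep_adj drep_adj inner_add_left inner_add_right)
  qed (simp add: pullback_covec_def covec_of_def[of "cotangent M"])
qed

end

section \<open>Poisson structures in coordinates\<close>

context cotangent_tangent_morphism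
begin

definition alternating :: bool where
  "alternating \<longleftrightarrow> (\<forall>p\<in>points M. \<forall>\<alpha>\<in>cotangent_space M p. \<alpha> (snd (lam (p, \<alpha>))) = 0)"

text \<open>Half the Schouten bracket of the bivector field with $P(\<alpha>, \<beta>) = \<langle>\<beta>, \<lambda>(\<alpha>)\<rangle>$, on covectors
  with components $a$, $b$, $g$.\<close>

definition jacobiator :: "('a, 'e) chart \<Rightarrow> 'e \<Rightarrow> 'e \<Rightarrow> 'e \<Rightarrow> 'e \<Rightarrow> real" where
  "jacobiator c x a b g =
     g \<bullet> drep c x b (rep c x a) + a \<bullet> drep c x g (rep c x b) + b \<bullet> drep c x a (rep c x g)"

lemma covec_of_lam:
  assumes c: "c \<in> M" "p \<in> cdom c"
  shows "covec_of M c p b (snd (lam (covec_pt c p w))) = b \<bullet> rep c (cmap c p) w"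
  by (simp add: lam_coords[OF c] covec_of_apply tvec_of_in tvec_of_chart c)

text \<open>The bracket only sees the values of $P$ on covectors, so any $P$ with these pairings gives
  the same result; the factor 2 is that of the two equal summands in $[P, P]$.\<close>

lemma schouten_coords:
  assumes P: "\<And>p \<alpha> \<beta>. p \<in> points M \<Longrightarrow> \<alpha> \<in> cotangent_space M p \<Longrightarrow> \<beta> \<in> cotangent_space M p \<Longrightarrow>
      P p \<alpha> \<beta> = \<beta> (snd (lam (p, \<alpha>)))"
    and p: "p \<in> points M" and c: "c = chart_at M p"
  shows "schouten M P P p (covec_of M c p a) (covec_of M c p b) (covec_of M c p g) =
    2 * jacobiator c (cmap c p) a b g"
proof -
  have cp: "c \<in> M" "p \<in> cdom c"
    using chart_at[OF p] by (auto simp: c)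
  have sharp: "sharp M P (covec_pt c p w) = tvec_pt c p (rep c (cmap c p) w)" for w
  proof (rule sharp_eqI[OF p tvec_of_in[OF cp]])
    fix \<beta> assume "\<beta> \<in> cotangent_space M p"
    from P[OF p covec_of_in this, of c w] show "\<beta> (tvec_of M c p (rep c (cmap c p) w)) = P p (covec_of M c p w) \<beta>"
      by (simp add: lam_coords[OF cp])
  qed
  have deriv: "bivec_deriv M c P p (covec_of M c p v) (covec_of M c p w) V = w \<bullet> drep c (cmap c p) v (V c)"
    for v w V
  proof -
    have "((\<lambda>x. w \<bullet> rep c x v) has_derivative (\<lambda>u. w \<bullet> drep c (cmap c p) v u)) (at (cmap c p))"
      by (rule has_derivative_inner_right[OF rep_has_derivative[OF cp]])
    then have "((\<lambda>x. P (cinv c x) (covec_of M c (cinv c x) v) (covec_of M c (cinv c x) w))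
        has_derivative (\<lambda>u. w \<bullet> drep c (cmap c p) v u)) (at (cmap c p))"
    proof (rule has_derivative_transform_within_open[OF _ open_chart[OF cp(1)]])
      fix x assume "x \<in> cmap c ` cdom c"
      then obtain q where q: "q \<in> cdom c" "x = cmap c q"
        by auto
      then show "w \<bullet> rep c x v = P (cinv c x) (covec_of M c (cinv c x) v) (covec_of M c (cinv c x) w)"
        using P[OF chart_point[OF cp(1) q(1)] covec_of_in covec_of_in] covec_of_lam[OF cp(1) q(1)] cp(1)
        by (simp add: cinv_cmap)
    qed (use cp in auto)
    from frechet_derivative_at[OF this] show ?thesis
      by (simp add: bivec_deriv_def covec_comp_of cp fun_eq_iff)
  qed
  show ?thesis
    unfolding schouten_def Let_def c[symmetric] deriv sharp snd_conv tvec_of_chart[OF cp] jacobiator_def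
    by simp
qed

text \<open>A bivector field that induces $\<lambda>$ has to be $P(\<alpha>, \<beta>) = \<langle>\<beta>, \<lambda>(\<alpha>)\<rangle>$ on covectors. It remains
  to ask whether this $P$ is alternating and satisfies $[P, P] = 0$; bilinearity and smoothness
  are those of $\<lambda>$.\<close>

lemma defines_poisson_coords:
  "defines_poisson M lam \<longleftrightarrow>
    alternating \<and> (\<forall>p\<in>points M. \<forall>a b g. jacobiator (chart_at M p) (cmap (chart_at M p) p) a b g = 0)"
  unfolding alternating_def
proof (intro iffI conjI ballI allI)
  assume "defines_poisson M lam"
  then obtain P where P: "bivector_field M P"
    and S: "\<And>p \<alpha> \<beta> \<gamma>. p \<in> points M \<Longrightarrow> \<alpha> \<in> cotangent_space M p \<Longrightarrow> \<beta> \<in> cotangent_space M p \<Longrightarrow>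
      \<gamma> \<in> cotangent_space M p \<Longrightarrow> schouten M P P p \<alpha> \<beta> \<gamma> = 0"
    and lam: "\<And>a. a \<in> points (cotangent M) \<Longrightarrow> lam a = sharp M P a"
    unfolding defines_poisson_def poisson_bivector_def by blast
  have eq: "P p \<alpha> \<beta> = \<beta> (snd (lam (p, \<alpha>)))"
    if "p \<in> points M" "\<alpha> \<in> cotangent_space M p" "\<beta> \<in> cotangent_space M p" for p \<alpha> \<beta>
    using bivector_sharp[OF P that] lam[of "(p, \<alpha>)"] that by (simp add: points_cotangent)
  fix p assume p: "p \<in> points M"
  show "\<alpha> (snd (lam (p, \<alpha>))) = 0" if "\<alpha> \<in> cotangent_space M p" for \<alpha>
    using eq[OF p that that] P p that by (simp add: bivector_field_def)
  show "jacobiator (chart_at M p) (cmap (chart_at M p) p) a b g = 0" for a b g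
    using schouten_coords[of P, OF eq p refl, of a b g] S[OF p covec_of_in covec_of_in covec_of_in] by simp
next
  assume *: "(\<forall>p\<in>points M. \<forall>\<alpha>\<in>cotangent_space M p. \<alpha> (snd (lam (p, \<alpha>))) = 0) \<and>
    (\<forall>p\<in>points M. \<forall>a b g. jacobiator (chart_at M p) (cmap (chart_at M p) p) a b g = 0)"
  define P where "P = (\<lambda>p \<alpha> \<beta>. \<beta> (snd (lam (p, \<alpha>))) :: real)"
  have "bivector_field M P"
    unfolding bivector_field_def
  proof (intro conjI ballI allI)
    fix p \<alpha> \<beta> \<gamma> r s
    assume p: "p \<in> points M" and \<alpha>: "\<alpha> \<in> cotangent_space M p" and \<beta>: "\<beta> \<in> cotangent_space M p"
      and \<gamma>: "\<gamma> \<in> cotangent_space M p"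
    show "P p \<alpha> \<alpha> = 0"
      using * p \<alpha> by (simp add: P_def)
    show "P p (\<lambda>v. r * \<alpha> v + s * \<beta> v) \<gamma> = r * P p \<alpha> \<gamma> + s * P p \<beta> \<gamma>"
      unfolding P_def lam_comb[OF p \<alpha> \<beta>]
      using \<gamma> lam_in(2)[OF p \<alpha>] lam_in(2)[OF p \<beta>] by (simp add: cotangent_space_def)
    show "P p \<gamma> (\<lambda>v. r * \<alpha> v + s * \<beta> v) = r * P p \<gamma> \<alpha> + s * P p \<gamma> \<beta>"
      by (simp add: P_def)
  next
    fix c i j assume c: "c \<in> M"
    show "smooth_on (cmap c ` cdom c) (\<lambda>x. P (cinv c x) (covec_of M c (cinv c x) i) (covec_of M c (cinv c x) j))"
    proof (rule smooth_on_cong[OF open_chart[OF c] _ smooth_rep_component[OF c]])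
      fix x assume "x \<in> cmap c ` cdom c"
      then show "j \<bullet> rep c x i = P (cinv c x) (covec_of M c (cinv c x) i) (covec_of M c (cinv c x) j)"
        using covec_of_lam[OF c] by (auto simp: P_def cinv_cmap[OF c])
    qed
  qed
  moreover have "schouten M P P p \<alpha> \<beta> \<gamma> = 0"
    if p: "p \<in> points M" and \<alpha>: "\<alpha> \<in> cotangent_space M p" and \<beta>: "\<beta> \<in> cotangent_space M p"
      and \<gamma>: "\<gamma> \<in> cotangent_space M p" for p \<alpha> \<beta> \<gamma>
  proof -
    let ?c = "chart_at M p"
    note c = chart_at[OF p]
    obtain a b g where "\<alpha> = covec_of M ?c p a" "\<beta> = covec_of M ?c p b" "\<gamma> = covec_of M ?c p g"
      using covec_pt_cases[OF c \<alpha>] covec_pt_cases[OF c \<beta>] covec_pt_cases[OF c \<gamma>] by metis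
    then show ?thesis
      using schouten_coords[of P, OF _ p refl, of a b g] * p by (simp add: P_def)
  qed
  moreover have "lam a = sharp M P a" if a': "a \<in> points (cotangent M)" for a
  proof -
    obtain p \<alpha> where a: "a = (p, \<alpha>)" "p \<in> points M" "\<alpha> \<in> cotangent_space M p"
      using a' by (auto simp: points_cotangent)
    have "sharp M P (p, \<alpha>) = (p, snd (lam (p, \<alpha>)))"
      by (rule sharp_eqI[OF a(2) lam_in(2)[OF a(2,3)]]) (simp add: P_def)
    then show ?thesis
      using lam_in(1)[OF a(2,3)] a(1) by metis
  qed
  ultimately show "defines_poisson M lam"
    unfolding defines_poisson_def poisson_bivector_def by blast
qed

section \<open>Comparison of the two relations\<close>

lemma left_side_coords:
  assumes p: "p \<in> points M" and c: "c = chart_at M p"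
  shows "tangent_map (cotangent M) (tangent M) lam (sharp (cotangent M) (canonical_bivector M)
      (covec_pt c p w, pullback_covec (cotangent M) (tangent M) lam (covec_pt c p w)
        (covec_of (tangent M) (tangent_chart M c) (lam (covec_pt c p w)) (a, b)))) =
    ttvec_pt c p (rep c (cmap c p) w) (- rep_adj c (cmap c p) b)
      (drep c (cmap c p) w (- rep_adj c (cmap c p) b) +
       rep c (cmap c p) (a + drep_adj c (cmap c p) w b))"
proof -
  have cp: "c \<in> M" "p \<in> cdom c"
    using chart_at[OF p] by (auto simp: c)
  show ?thesis
    unfolding pullback_covec_coords[OF cp] canonical_sharp_coords[OF p c] tangent_map_lam[OF cp] ..
qed

lemma right_side_coords:
  assumes p: "p \<in> points M" and c: "c = chart_at M p"
  shows "canonical_flip M (tangent_map (cotangent M) (tangent M) lam (epsilon_map M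
      (lam (covec_pt c p w), covec_of (tangent M) (tangent_chart M c) (lam (covec_pt c p w)) (a, b)))) =
    ttvec_pt c p (rep c (cmap c p) w) (rep c (cmap c p) b)
      (drep c (cmap c p) b (rep c (cmap c p) w) + rep c (cmap c p) a)"
proof -
  have cp: "c \<in> M" "p \<in> cdom c"
    using chart_at[OF p] by (auto simp: c)
  show ?thesis
    unfolding lam_coords[OF cp] epsilon_map_coords[OF p c] tangent_map_lam[OF cp] canonical_flip_coords[OF p c] ..
qed

text \<open>Both sides lie over the same vector of $TM$, so only their two vector components are
  compared. The first components do not involve \<open>a\<close>; in the second ones it contributes \<open>rep c x
  a\<close> on both sides, by linearity in the fibre, and cancels.\<close>

lemma sides_eq_iff:
  assumes p: "p \<in> points M" and c: "c = chart_at M p"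
  shows "(\<forall>\<alpha>\<in>cotangent_space M p. \<forall>\<xi>\<in>cotangent_space (tangent M) (lam (p, \<alpha>)).
      tangent_map (cotangent M) (tangent M) lam (sharp (cotangent M) (canonical_bivector M)
        ((p, \<alpha>), pullback_covec (cotangent M) (tangent M) lam (p, \<alpha>) \<xi>)) =
      canonical_flip M (tangent_map (cotangent M) (tangent M) lam (epsilon_map M (lam (p, \<alpha>), \<xi>)))) \<longleftrightarrow>
    (\<forall>w b. - rep_adj c (cmap c p) b = rep c (cmap c p) b \<and>
      drep c (cmap c p) w (rep c (cmap c p) b) + rep c (cmap c p) (drep_adj c (cmap c p) w b) =
      drep c (cmap c p) b (rep c (cmap c p) w))" (is "?l = ?r")
proof -
  have cp: "c \<in> M" "p \<in> cdom c"
    using chart_at[OF p] by (auto simp: c)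
  let ?L = "rep c (cmap c p)" and ?D = "drep c (cmap c p)"
  let ?E = "\<lambda>w a b. ttvec_pt c p (?L w) (- rep_adj c (cmap c p) b)
      (?D w (- rep_adj c (cmap c p) b) + ?L (a + drep_adj c (cmap c p) w b)) =
    ttvec_pt c p (?L w) (?L b) (?D b (?L w) + ?L a)"
  have E: "?E w a b \<longleftrightarrow> - rep_adj c (cmap c p) b = ?L b \<and>
      ?D w (?L b) + ?L (drep_adj c (cmap c p) w b) = ?D b (?L w)" for w a b
  proof -
    have "?E w a b \<longleftrightarrow> (- rep_adj c (cmap c p) b, ?D w (- rep_adj c (cmap c p) b) + ?L (a + drep_adj c (cmap c p) w b)) =
        (?L b, ?D b (?L w) + ?L a)"
      using ttvec_pt_chart[OF cp(1) cp] by (metis prod.inject)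
    then show ?thesis
      by (auto simp: linear_add[OF linear_rep[OF cp]])
  qed
  have "?l \<longleftrightarrow> (\<forall>w a b. ?E w a b)"
  proof
    assume l: ?l
    show "\<forall>w a b. ?E w a b"
      using l covec_of_in[of c p] TM.covec_of_in[of "tangent_chart M c" "lam (covec_pt c p _)"]
        left_side_coords[OF p c] right_side_coords[OF p c] by simp
  next
    assume r: "\<forall>w a b. ?E w a b"
    show ?l
    proof (intro ballI)
      fix \<alpha> \<xi> assume \<alpha>: "\<alpha> \<in> cotangent_space M p" and \<xi>: "\<xi> \<in> cotangent_space (tangent M) (lam (p, \<alpha>))"
      obtain w where w: "\<alpha> = covec_of M c p w"
        using covec_pt_cases[OF cp \<alpha>] by blast
      have "covec_of (tangent M) (tangent_chart M c) (lam (p, \<alpha>))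
          (covec_comp (tangent M) (tangent_chart M c) (lam (p, \<alpha>)) \<xi>) = \<xi>"
        by (rule TM.covec_of_comp[OF tangent_chart_in[OF cp(1)] _ \<xi>])
          (simp add: w lam_coords[OF cp] tvec_pt_in[OF cp])
      then obtain a b where "\<xi> = covec_of (tangent M) (tangent_chart M c) (lam (p, \<alpha>)) (a, b)"
        by (metis prod.exhaust)
      then show "tangent_map (cotangent M) (tangent M) lam (sharp (cotangent M) (canonical_bivector M)
          ((p, \<alpha>), pullback_covec (cotangent M) (tangent M) lam (p, \<alpha>) \<xi>)) =
        canonical_flip M (tangent_map (cotangent M) (tangent M) lam (epsilon_map M (lam (p, \<alpha>), \<xi>)))"
        using r left_side_coords[OF p c] right_side_coords[OF p c] w by simp
    qed
  qed
  then show ?thesis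
    using E by simp
qed

lemma skew_iff:
  assumes p: "p \<in> points M" and c: "c = chart_at M p"
  shows "(\<forall>\<alpha>\<in>cotangent_space M p. \<alpha> (snd (lam (p, \<alpha>))) = 0) \<longleftrightarrow>
    (\<forall>b. - rep_adj c (cmap c p) b = rep c (cmap c p) b)"
proof -
  have cp: "c \<in> M" "p \<in> cdom c"
    using chart_at[OF p] by (auto simp: c)
  let ?L = "rep c (cmap c p)"
  have "(\<forall>\<alpha>\<in>cotangent_space M p. \<alpha> (snd (lam (p, \<alpha>))) = 0) \<longleftrightarrow> (\<forall>w. w \<bullet> ?L w = 0)"
    using covec_of_lam[OF cp] covec_of_in[of c p] covec_pt_cases[OF cp] by metis
  also have "\<dots> \<longleftrightarrow> (\<forall>b. - rep_adj c (cmap c p) b = ?L b)"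
  proof (intro iffI allI)
    fix b assume alt: "\<forall>w. w \<bullet> ?L w = 0"
    have "(?L b + rep_adj c (cmap c p) b) \<bullet> z = 0" for z
      using alt[rule_format, of "b + z"] alt[rule_format, of b] alt[rule_format, of z]
      by (simp add: linear_add[OF linear_rep[OF cp]] inner_add_left inner_add_right rep_adj[OF cp]
          inner_commute[of "?L b" z])
    then have "?L b + rep_adj c (cmap c p) b = 0"
      using inner_eq_zero_iff by blast
    then show "- rep_adj c (cmap c p) b = ?L b"
      by (metis eq_neg_iff_add_eq_0)
  next
    fix w assume "\<forall>b. - rep_adj c (cmap c p) b = ?L b"
    then have "w \<bullet> ?L w = - (rep_adj c (cmap c p) w \<bullet> w)"
      by (metis inner_commute inner_minus_right)
    then show "w \<bullet> ?L w = 0"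
      by (simp add: rep_adj[OF cp])
  qed
  finally show ?thesis .
qed

context
  assumes alternating: alternating
begin

lemma skew_rep:
  assumes c: "c \<in> M" "p \<in> cdom c"
  shows "v \<bullet> rep c (cmap c p) w = - (w \<bullet> rep c (cmap c p) v)"
proof -
  have alt: "u \<bullet> rep c (cmap c p) u = 0" for u
    using alternating chart_point[OF c] covec_of_in covec_of_lam[OF c] unfolding alternating_def by metis
  show ?thesis
    using alt[of "v + w"] alt[of v] alt[of w]
    by (simp add: linear_add[OF linear_rep[OF c]] inner_add_left inner_add_right)
qed

text \<open>Differentiating the skew-symmetry of \<open>rep\<close> requires it on a whole neighbourhood; this is
  where skew-symmetry at all points enters, rather than at the point considered.\<close>

lemma skew_drep:
  assumes c: "c \<in> M" "p \<in> cdom c"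
  shows "v \<bullet> drep c (cmap c p) w u = - (w \<bullet> drep c (cmap c p) v u)"
proof -
  have "((\<lambda>x. v \<bullet> rep c x w) has_derivative (\<lambda>u. v \<bullet> drep c (cmap c p) w u)) (at (cmap c p))"
    by (rule has_derivative_inner_right[OF rep_has_derivative[OF c]])
  then have "((\<lambda>x. - (w \<bullet> rep c x v)) has_derivative (\<lambda>u. v \<bullet> drep c (cmap c p) w u)) (at (cmap c p))"
    by (rule has_derivative_transform_within_open[OF _ open_chart[OF c(1)]])
      (use c skew_rep[OF c(1), of _ v w] in auto)
  moreover have "((\<lambda>x. - (w \<bullet> rep c x v)) has_derivative (\<lambda>u. - (w \<bullet> drep c (cmap c p) v u))) (at (cmap c p))"
    by (intro has_derivative_minus has_derivative_inner_right rep_has_derivative c)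
  ultimately show ?thesis
    using has_derivative_unique by (metis (no_types, lifting))
qed

text \<open>Skew-symmetry of \<open>rep\<close> moves it from the transpose term to $r$, and skew-symmetry of
  \<open>drep\<close> exchanges $r$ and $w$ in the first term; the three terms become those of the cyclic
  sum.\<close>

lemma jacobiator_eq_pairing:
  assumes c: "c \<in> M" "p \<in> cdom c"
  shows "r \<bullet> (drep c (cmap c p) w (rep c (cmap c p) b) + rep c (cmap c p) (drep_adj c (cmap c p) w b) -
      drep c (cmap c p) b (rep c (cmap c p) w)) = - jacobiator c (cmap c p) b r w"
  using skew_rep[OF c, of r "drep_adj c (cmap c p) w b"] skew_drep[OF c, of r w "rep c (cmap c p) b"]
  by (simp add: inner_add_right inner_diff_right drep_adj[OF c] jacobiator_def)

end

lemma defines_poisson_iff_sides_eq: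
  "defines_poisson M lam \<longleftrightarrow>
    (\<forall>a \<in> points (cotangent M). \<forall>\<xi> \<in> cotangent_space (tangent M) (lam a).
      tangent_map (cotangent M) (tangent M) lam (sharp (cotangent M) (canonical_bivector M)
        (a, pullback_covec (cotangent M) (tangent M) lam a \<xi>)) =
      canonical_flip M (tangent_map (cotangent M) (tangent M) lam (epsilon_map M (lam a, \<xi>))))"
proof -
  let ?x = "\<lambda>p. cmap (chart_at M p) p"
  let ?skew = "\<forall>p\<in>points M. \<forall>b. - rep_adj (chart_at M p) (?x p) b = rep (chart_at M p) (?x p) b"
  let ?X = "\<lambda>p w b. drep (chart_at M p) (?x p) w (rep (chart_at M p) (?x p) b) +
    rep (chart_at M p) (?x p) (drep_adj (chart_at M p) (?x p) w b) -
    drep (chart_at M p) (?x p) b (rep (chart_at M p) (?x p) w)"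
  have "defines_poisson M lam \<longleftrightarrow> ?skew \<and> (\<forall>p\<in>points M. \<forall>a b g. jacobiator (chart_at M p) (?x p) a b g = 0)"
    unfolding defines_poisson_coords alternating_def using skew_iff by simp
  also have "\<dots> \<longleftrightarrow> ?skew \<and> (\<forall>p\<in>points M. \<forall>w b. ?X p w b = 0)"
  proof (rule conj_cong[OF refl], rule ball_cong[OF refl])
    fix p assume ?skew and p: "p \<in> points M"
    then have alternating
      unfolding alternating_def using skew_iff by simp
    then have "r \<bullet> ?X p w b = - jacobiator (chart_at M p) (?x p) b r w" for r w b
      by (rule jacobiator_eq_pairing[OF _ chart_at[OF p]])
    then show "(\<forall>a b g. jacobiator (chart_at M p) (?x p) a b g = 0) \<longleftrightarrow> (\<forall>w b. ?X p w b = 0)"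
      by (metis add.inverse_neutral inner_eq_zero_iff inner_zero_right neg_equal_0_iff_equal)
  qed
  also have "\<dots> \<longleftrightarrow> (\<forall>p\<in>points M. \<forall>w b. - rep_adj (chart_at M p) (?x p) b = rep (chart_at M p) (?x p) b \<and>
      drep (chart_at M p) (?x p) w (rep (chart_at M p) (?x p) b) +
      rep (chart_at M p) (?x p) (drep_adj (chart_at M p) (?x p) w b) =
      drep (chart_at M p) (?x p) b (rep (chart_at M p) (?x p) w))"
    by auto
  also have "\<dots> \<longleftrightarrow> (\<forall>p\<in>points M. \<forall>\<alpha>\<in>cotangent_space M p. \<forall>\<xi>\<in>cotangent_space (tangent M) (lam (p, \<alpha>)).
      tangent_map (cotangent M) (tangent M) lam (sharp (cotangent M) (canonical_bivector M)
        ((p, \<alpha>), pullback_covec (cotangent M) (tangent M) lam (p, \<alpha>) \<xi>)) =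
      canonical_flip M (tangent_map (cotangent M) (tangent M) lam (epsilon_map M (lam (p, \<alpha>), \<xi>))))"
    using sides_eq_iff by simp
  finally show ?thesis
    by (simp add: points_cotangent)
qed

text \<open>The composed relation leaves nothing out: a pulled back covector is a covector on $T^*M$,
  and its contraction with the canonical bivector is a tangent vector of $T^*M$.\<close>

lemma pullback_sharp_in:
  assumes a: "a \<in> points (cotangent M)" and \<xi>: "\<xi> \<in> cotangent_space (tangent M) (lam a)"
  shows "(a, pullback_covec (cotangent M) (tangent M) lam a \<xi>) \<in> points (cotangent (cotangent M))"
    and "sharp (cotangent M) (canonical_bivector M) (a, pullback_covec (cotangent M) (tangent M) lam a \<xi>)
      \<in> points (tangent (cotangent M))"
proof -
  obtain p \<alpha> where p: "a = (p, \<alpha>)" "p \<in> points M" "\<alpha> \<in> cotangent_space M p"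
    using a by (auto simp: points_cotangent)
  let ?c = "chart_at M p"
  note c = chart_at[OF p(2)]
  obtain w where w: "\<alpha> = covec_of M ?c p w"
    using covec_pt_cases[OF c p(3)] by blast
  have "covec_of (tangent M) (tangent_chart M ?c) (lam a)
      (covec_comp (tangent M) (tangent_chart M ?c) (lam a) \<xi>) = \<xi>"
    by (rule TM.covec_of_comp[OF tangent_chart_in[OF c(1)] _ \<xi>])
      (simp add: p(1) w lam_coords[OF c] tvec_pt_in[OF c])
  then obtain s b where \<xi>': "\<xi> = covec_of (tangent M) (tangent_chart M ?c) (lam a) (s, b)"
    by (metis prod.exhaust)
  show "(a, pullback_covec (cotangent M) (tangent M) lam a \<xi>) \<in> points (cotangent (cotangent M))"
    unfolding \<xi>' using a unfolding p(1) w pullback_covec_coords[OF c]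
    by (simp add: cotM.points_cotangent cotM.covec_of_in)
  show "sharp (cotangent M) (canonical_bivector M) (a, pullback_covec (cotangent M) (tangent M) lam a \<xi>)
      \<in> points (tangent (cotangent M))"
    unfolding \<xi>' using a unfolding p(1) w pullback_covec_coords[OF c] canonical_sharp_coords[OF p(2) refl]
    by (simp add: cotM.points_tangent tcovec_pt_in[OF c])
qed

end

theorem theorem4p5:
  fixes M :: "('a, 'e::real_inner) atlas"
    and lam :: "'a \<times> ('a, 'e) covec \<Rightarrow> 'a \<times> ('a, 'e) tvec"
  assumes "smooth_manifold M"
    and "bundle_morphism M lam"
  defines "T_lam \<equiv> tangent_map (cotangent M) (tangent M) lam"
    and "sharp_M \<equiv> sharp (cotangent M) (canonical_bivector M)"
  shows
    "(defines_poisson M lam \<longleftrightarrow>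
        cotangent_rel (cotangent M) (tangent M) lam
          O graph_on (points (cotangent (cotangent M))) sharp_M
          O graph_on (points (tangent (cotangent M))) T_lam
        = graph_on (SIGMA y:lam ` points (cotangent M). cotangent_space (tangent M) y)
            (canonical_flip M \<circ> T_lam \<circ> epsilon_map M)) \<and>
     (defines_poisson M lam \<longleftrightarrow>
        (\<forall>a \<in> points (cotangent M). \<forall>\<xi> \<in> cotangent_space (tangent M) (lam a).
           T_lam (sharp_M (a, pullback_covec (cotangent M) (tangent M) lam a \<xi>))
           = canonical_flip M (T_lam (epsilon_map M (lam a, \<xi>)))))"
proof -
  interpret cotangent_tangent_morphism M lam
    using assms by unfold_locales
  let ?f = "\<lambda>a \<xi>. T_lam (sharp_M (a, pullback_covec (cotangent M) (tangent M) lam a \<xi>))"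
  let ?g = "\<lambda>a \<xi>. canonical_flip M (T_lam (epsilon_map M (lam a, \<xi>)))"
  let ?S = "SIGMA a:points (cotangent M). cotangent_space (tangent M) (lam a)"
  have "cotangent_rel (cotangent M) (tangent M) lam
      O graph_on (points (cotangent (cotangent M))) sharp_M
      O graph_on (points (tangent (cotangent M))) T_lam = (\<lambda>(a, \<xi>). ((lam a, \<xi>), ?f a \<xi>)) ` ?S" (is "?L = _")
  proof (intro equalityI subsetI)
    fix z assume "z \<in> (\<lambda>(a, \<xi>). ((lam a, \<xi>), ?f a \<xi>)) ` ?S"
    then obtain a \<xi> where a: "a \<in> points (cotangent M)" "\<xi> \<in> cotangent_space (tangent M) (lam a)"
      and z: "z = ((lam a, \<xi>), ?f a \<xi>)"
      by auto
    let ?b = "(a, pullback_covec (cotangent M) (tangent M) lam a \<xi>)"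
    have "((lam a, \<xi>), ?b) \<in> cotangent_rel (cotangent M) (tangent M) lam"
      using a unfolding cotangent_rel_def by blast
    moreover have "(?b, sharp_M ?b) \<in> graph_on (points (cotangent (cotangent M))) sharp_M"
      using pullback_sharp_in(1)[OF a] unfolding graph_on_def by blast
    moreover have "(sharp_M ?b, T_lam (sharp_M ?b)) \<in> graph_on (points (tangent (cotangent M))) T_lam"
      using pullback_sharp_in(2)[OF a] unfolding graph_on_def sharp_M_def by blast
    ultimately show "z \<in> ?L"
      unfolding z by blast
  qed (auto simp: cotangent_rel_def graph_on_def)
  moreover have "graph_on (SIGMA y:lam ` points (cotangent M). cotangent_space (tangent M) y)
      (canonical_flip M \<circ> T_lam \<circ> epsilon_map M) = (\<lambda>(a, \<xi>). ((lam a, \<xi>), ?g a \<xi>)) ` ?S"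
    (is "?R = _")
  proof (intro equalityI subsetI)
    fix z assume "z \<in> ?R"
    then obtain a \<xi> where "a \<in> points (cotangent M)" "\<xi> \<in> cotangent_space (tangent M) (lam a)"
      "z = ((lam a, \<xi>), ?g a \<xi>)"
      unfolding graph_on_def comp_def by blast
    then show "z \<in> (\<lambda>(a, \<xi>). ((lam a, \<xi>), ?g a \<xi>)) ` ?S"
      by (intro rev_image_eqI[of "(a, \<xi>)"]) simp_all
  next
    fix z assume "z \<in> (\<lambda>(a, \<xi>). ((lam a, \<xi>), ?g a \<xi>)) ` ?S"
    then obtain a \<xi> where "a \<in> points (cotangent M)" "\<xi> \<in> cotangent_space (tangent M) (lam a)"
      "z = ((lam a, \<xi>), ?g a \<xi>)"
      by auto
    then show "z \<in> ?R"
      unfolding graph_on_def comp_def by blast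
  qed
  moreover have "(\<lambda>(a, \<xi>). ((lam a, \<xi>), ?f a \<xi>)) ` ?S = (\<lambda>(a, \<xi>). ((lam a, \<xi>), ?g a \<xi>)) ` ?S \<longleftrightarrow>
      (\<forall>(a, \<xi>)\<in>?S. ?f a \<xi> = ?g a \<xi>)"
  proof
    assume eq: "(\<lambda>(a, \<xi>). ((lam a, \<xi>), ?f a \<xi>)) ` ?S = (\<lambda>(a, \<xi>). ((lam a, \<xi>), ?g a \<xi>)) ` ?S"
    have "?f a \<xi> = ?g a \<xi>" if "(a, \<xi>) \<in> ?S" for a \<xi>
    proof -
      have "((lam a, \<xi>), ?f a \<xi>) \<in> (\<lambda>(a, \<xi>). ((lam a, \<xi>), ?g a \<xi>)) ` ?S"
        unfolding eq[symmetric] using that by (rule rev_image_eqI) simp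
      \<comment> \<open>The right side depends on \<open>a\<close> only through \<open>lam a\<close>.\<close>
      then show ?thesis
        by auto
    qed
    then show "\<forall>(a, \<xi>)\<in>?S. ?f a \<xi> = ?g a \<xi>"
      by blast
  qed (auto intro!: image_cong)
  ultimately show ?thesis
    using defines_poisson_iff_sides_eq unfolding T_lam_def sharp_M_def by auto
qed

end
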